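(* Let $\Phi:\mathbb{R}\to\mathbb{R}$ be smooth and convex. Then: (1) If $\sigma\in\mathbb{R}$ and $R,V\in C^1(\mathbb{R})\cap L^\infty(\mathbb{R})$ form a front with speed $\sigma$ and asymptotic states $(r_\pm,v_\pm)$, then $(r_\pm,v_\pm)$ and $\sigma$ define a conservative shock of the p-system, i.e. $$\sigma[\![r]\!]+[\![v]\!]=0,\qquad \sigma[\![v]\!]+[\![\Phi'(r)]\!]=0,\qquad \sigma[\![\tfrac12 v^2+\Phi(r)]\!]+[\![\Phi'(r)v]\!]=0 .$$ (2) Conversely, let $(r_-,v_-)\neq(r_+,v_+)$ and $\sigma\in\mathbb{R}$ satisfy the three jump conditions above, suppose the shock is supersonic, i.e. $|\sigma|>\sqrt{\Phi''(r_-)}$ and $|\sigma|>\sqrt{\Phi''(r_+)}$, and suppose the area condition holds: $g(w)>0$ for all $w\in(-1,1)$. Then there exists a front $(R,V)$ with speed $\sigma$ and asymptotic states $(r_\pm,v_\pm)$ whose profiles $R$ and $V$ are monotone.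
   Context: A front with speed $\sigma$ and asymptotic states $(r_\pm,v_\pm)$ is a pair of functions $R,V\in C^1(\mathbb{R})\cap L^\infty(\mathbb{R})$ with $R(\varphi)\to r_\pm$, $V(\varphi)\to v_\pm$ as $\varphi\to\pm\infty$, solving the advance-delay equations $$\sigma R'(\varphi)+V(\varphi+1)-V(\varphi)=0,\qquad \sigma V'(\varphi)+\Phi'(R(\varphi))-\Phi'(R(\varphi-1))=0\quad(\varphi\in\mathbb{R}).$$ (These are exactly the travelling waves $r_\alpha(t)=x_{\alpha+1}-x_\alpha=R(\alpha-\sigma t)$, $v_\alpha(t)=\dot x_\alpha=V(\alpha-\sigma t)$ of the chain $\ddot x_\alpha=\Phi'(x_{\alpha+1}-x_\alpha)-\Phi'(x_\alpha-x_{\alpha-1})$, $\alpha\in\mathbb{Z}$.) For an observable $\psi(r,v)$, $[\![\psi]\!]=\psi(r_+,v_+)-\psi(r_-,v_-)$ and $\langle\psi\rangle=\tfrac12(\psi(r_+,v_+)+\psi(r_-,v_-))$. Under the hypotheses of (2) one has $[\![r]\!]\neq0$ and $[\![\Phi'(r)]\!]=\sigma^2[\![r]\!]\ne 0$, and the normalised potential is $$\widehat\Phi(w)=\frac{4}{[\![\Phi'(r)]\!]\,[\![r]\!]}\,\Phi\big(\langle r\rangle+\tfrac12[\![r]\!]w\big)-\frac{2\langle\Phi'(r)\rangle}{[\![\Phi'(r)]\!]}\,w,$$ and $g(w)=\int_{-1}^{w}\big(u-\widehat\Phi'(u)\big)\,du$. *)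

theory Defs
  imports "HOL-Analysis.Analysis"
begin

definition smooth_fun :: "(real \<Rightarrow> real) \<Rightarrow> bool" where
  "smooth_fun f \<longleftrightarrow> (\<forall>n x. ((deriv ^^ n) f) differentiable (at x))"

definition C1_bounded :: "(real \<Rightarrow> real) \<Rightarrow> bool" where
  "C1_bounded f \<longleftrightarrow> (\<forall>x. f differentiable (at x)) \<and> continuous_on UNIV (deriv f) \<and> bounded (range f)"

definition is_front :: "(real \<Rightarrow> real) \<Rightarrow> real \<Rightarrow> real \<Rightarrow> real \<Rightarrow> real \<Rightarrow> real
    \<Rightarrow> (real \<Rightarrow> real) \<Rightarrow> (real \<Rightarrow> real) \<Rightarrow> bool" where
  "is_front \<Phi> \<sigma> rm vm rp vp R V \<longleftrightarrow>
     C1_bounded R \<and> C1_bounded V \<and>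
     (R \<longlongrightarrow> rp) at_top \<and> (R \<longlongrightarrow> rm) at_bot \<and>
     (V \<longlongrightarrow> vp) at_top \<and> (V \<longlongrightarrow> vm) at_bot \<and>
     (\<forall>\<phi>. \<sigma> * deriv R \<phi> + V (\<phi> + 1) - V \<phi> = 0) \<and>
     (\<forall>\<phi>. \<sigma> * deriv V \<phi> + deriv \<Phi> (R \<phi>) - deriv \<Phi> (R (\<phi> - 1)) = 0)"

definition jump :: "(real \<Rightarrow> real \<Rightarrow> real) \<Rightarrow> real \<Rightarrow> real \<Rightarrow> real \<Rightarrow> real \<Rightarrow> real" where
  "jump \<psi> rm vm rp vp = \<psi> rp vp - \<psi> rm vm"

definition mean :: "(real \<Rightarrow> real \<Rightarrow> real) \<Rightarrow> real \<Rightarrow> real \<Rightarrow> real \<Rightarrow> real \<Rightarrow> real" where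
  "mean \<psi> rm vm rp vp = (\<psi> rp vp + \<psi> rm vm) / 2"

definition conservative_shock :: "(real \<Rightarrow> real) \<Rightarrow> real \<Rightarrow> real \<Rightarrow> real \<Rightarrow> real \<Rightarrow> real \<Rightarrow> bool" where
  "conservative_shock \<Phi> \<sigma> rm vm rp vp \<longleftrightarrow>
     \<sigma> * jump (\<lambda>r v. r) rm vm rp vp + jump (\<lambda>r v. v) rm vm rp vp = 0 \<and>
     \<sigma> * jump (\<lambda>r v. v) rm vm rp vp + jump (\<lambda>r v. deriv \<Phi> r) rm vm rp vp = 0 \<and>
     \<sigma> * jump (\<lambda>r v. v\<^sup>2 / 2 + \<Phi> r) rm vm rp vp + jump (\<lambda>r v. deriv \<Phi> r * v) rm vm rp vp = 0"

definition Phi_hat :: "(real \<Rightarrow> real) \<Rightarrow> real \<Rightarrow> real \<Rightarrow> real \<Rightarrow> real \<Rightarrow> real \<Rightarrow> real" where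
  "Phi_hat \<Phi> rm vm rp vp w =
     4 / (jump (\<lambda>r v. deriv \<Phi> r) rm vm rp vp * jump (\<lambda>r v. r) rm vm rp vp)
       * \<Phi> (mean (\<lambda>r v. r) rm vm rp vp + jump (\<lambda>r v. r) rm vm rp vp / 2 * w)
     - 2 * mean (\<lambda>r v. deriv \<Phi> r) rm vm rp vp / jump (\<lambda>r v. deriv \<Phi> r) rm vm rp vp * w"

definition g_area :: "(real \<Rightarrow> real) \<Rightarrow> real \<Rightarrow> real \<Rightarrow> real \<Rightarrow> real \<Rightarrow> real \<Rightarrow> real" where
  "g_area \<Phi> rm vm rp vp w = integral {-1..w} (\<lambda>u. u - deriv (Phi_hat \<Phi> rm vm rp vp) u)"

end

theory Submission
  imports Defs "HOL-Complex_Analysis.Great_Picard"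
begin

text \<open>Each travelling-wave equation has the form \<open>s F' x + H (x + 1) - H x = 0\<close>, so \<open>s F\<close> plus the average
  of \<open>H\<close> over \<open>[x, x + 1]\<close> is constant; comparing its limits gives a jump condition. The energy identity has
  the same form with \<open>F = V\<^sup>2 / 2 + \<Phi>(R)\<close> and \<open>H x = \<Phi>'(R (x - 1)) V x\<close>.

  For the converse one normalises to the end states \<open>-1\<close> and \<open>1\<close> and looks for a monotone \<open>W\<close> that is the twofold
  unit-window average of \<open>\<Psi> \<circ> W\<close>, where \<open>\<Psi>\<close> is the derivative of the normalised potential.
  On \<open>[-L, L]\<close>, with \<open>\<Psi> \<circ> W\<close> replaced by \<open>-1\<close> to the left and \<open>1\<close> to the right, monotone iteration yields a
  solution. Its local energy starts at \<open>e0 = 1/2 - F 1\<close>, decreases left of \<open>-L\<close>, is constant on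
  \<open>[-L, L]\<close> and returns to \<open>e0\<close> on the right. A monotone profile is nearly constant somewhere in a long
  interval, so the area condition forces the energy to stay within \<open>O(1 / L)\<close> of \<open>e0\<close>, and the energy loss bounds
  the defect in the equation outside \<open>[-L, L]\<close>. After centring, a subsequence converges to an exact
  solution of energy \<open>e0\<close>; its end states \<open>w\<close> satisfy \<open>g w = 0\<close>, hence \<open>w = -1\<close> and \<open>w = 1\<close>. The bounds do not depend
  on where the front sits in \<open>[-L, L]\<close>.\<close>

section \<open>Unit-window averages\<close>

definition locally_integrable :: "(real \<Rightarrow> real) \<Rightarrow> bool" where
  "locally_integrable f \<longleftrightarrow> (\<forall>a b. f integrable_on {a..b})"

definition win :: "(real \<Rightarrow> real) \<Rightarrow> real \<Rightarrow> real" where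
  "win f x = integral {x..x+1} f"

lemma locally_integrable_mono: "mono f \<Longrightarrow> locally_integrable f"
  unfolding locally_integrable_def by (metis integrable_on_mono_on mono_on_subset top_greatest)

lemma locally_integrable_continuous: "continuous_on UNIV f \<Longrightarrow> locally_integrable f"
  unfolding locally_integrable_def
  by (metis integrable_continuous_real continuous_on_subset top_greatest)

text \<open>A product of monotone functions need not be monotone, but adding 1 makes both factors
  nonnegative and then it is. Subtracting the extra terms keeps integrability. This makes
  \<open>flux\<close> integrable for discontinuous profiles.\<close>

lemma locally_integrable_mult_mono:
  assumes "mono f" "mono g" "\<And>x. \<bar>f x\<bar> \<le> 1" "\<And>x. \<bar>g x\<bar> \<le> 1"
  shows "locally_integrable (\<lambda>x. f x * g x)"
  unfolding locally_integrable_def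
proof (intro allI)
  fix a b
  have 1: "mono (\<lambda>x. (f x + 1) * (g x + 1))"
  proof (rule monoI)
    fix x y :: real assume "x \<le> y"
    then have "f x \<le> f y" "g x \<le> g y" using assms(1,2) by (simp_all add: monoD)
    moreover have "-1 \<le> f x" "-1 \<le> g x" using assms(3,4)[of x] by auto
    ultimately show "(f x + 1) * (g x + 1) \<le> (f y + 1) * (g y + 1)"
      by (intro mult_mono) auto
  qed
  have "(\<lambda>x. (f x + 1) * (g x + 1) - f x - g x - 1) integrable_on {a..b}"
    using locally_integrable_mono[OF 1] locally_integrable_mono[OF assms(1)]
      locally_integrable_mono[OF assms(2)]
    unfolding locally_integrable_def by (intro integrable_diff) auto
  then show "(\<lambda>x. f x * g x) integrable_on {a..b}"
    by (simp add: algebra_simps)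
qed

lemma win_shift: "win (\<lambda>y. f (y + s)) x = win f (x + s)"
  using integral_shift_real_ivl[of "x+s" s "x+s+1" f] by (simp add: win_def algebra_simps)

lemma win_const_on:
  assumes "\<And>y. x \<le> y \<Longrightarrow> y \<le> x + 1 \<Longrightarrow> f y = c"
  shows "win f x = c"
proof -
  have "win f x = integral {x..x+1} (\<lambda>y. c)"
    unfolding win_def by (rule integral_cong) (use assms in auto)
  then show ?thesis by simp
qed

lemma win_const [simp]: "win (\<lambda>x. c) x = c"
  by (rule win_const_on) simp

lemma win_mono_at:
  assumes "locally_integrable f" "locally_integrable g"
    and "\<And>y. x \<le> y \<Longrightarrow> y \<le> x + 1 \<Longrightarrow> f y \<le> g y"
  shows "win f x \<le> win g x"
  unfolding win_def by (rule integral_le) (use assms in \<open>auto simp: locally_integrable_def\<close>)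

lemma locally_integrable_const [simp]: "locally_integrable (\<lambda>x. c)"
  by (simp add: locally_integrable_def integrable_const_ivl)

lemma win_le:
  assumes "locally_integrable f" "\<And>y. x \<le> y \<Longrightarrow> y \<le> x + 1 \<Longrightarrow> f y \<le> c"
  shows "win f x \<le> c"
  using win_mono_at[of f "\<lambda>_. c" x] assms by simp

lemma win_ge:
  assumes "locally_integrable f" "\<And>y. x \<le> y \<Longrightarrow> y \<le> x + 1 \<Longrightarrow> c \<le> f y"
  shows "c \<le> win f x"
  using win_mono_at[of "\<lambda>_. c" f x] assms by simp

lemma win_abs_le:
  assumes "locally_integrable f" "\<And>y. \<bar>f y\<bar> \<le> c"
  shows "\<bar>win f x\<bar> \<le> c"
proof -
  have "f y \<le> c" "- c \<le> f y" for y using assms(2)[of y] by auto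
  then have "win f x \<le> c" "-c \<le> win f x"
    using win_le[OF assms(1), of x c] win_ge[OF assms(1), of x "-c"] by simp_all
  then show ?thesis by auto
qed

lemma locally_integrable_shift:
  assumes "locally_integrable f" shows "locally_integrable (\<lambda>y. f (y + s))"
  unfolding locally_integrable_def
  using assms integrable_shift_real_ivl[of f "a+s" "b+s" s for a b]
  by (auto simp: locally_integrable_def)

lemma mono_win:
  assumes "mono f" shows "mono (win f)"
proof (rule monoI)
  fix x y :: real assume "x \<le> y"
  have "win (\<lambda>t. f (t + x)) 0 \<le> win (\<lambda>t. f (t + y)) 0"
  proof (rule win_mono_at)
    show "f (t + x) \<le> f (t + y)" for t
      using monoD[OF assms, of "t + x" "t + y"] \<open>x \<le> y\<close> by simp
  qed (rule locally_integrable_shift[OF locally_integrable_mono[OF assms]])+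
  then show "win f x \<le> win f y" by (simp add: win_shift)
qed

text \<open>Locally the average is a difference of two values of one primitive. Continuity is asked
  only at the two ends of the window, so that averages can be differentiated although truncated
  profiles jump elsewhere.\<close>

lemma win_has_derivative:
  assumes li: "locally_integrable f" and "isCont f x" "isCont f (x+1)"
  shows "(win f has_real_derivative f (x+1) - f x) (at x)"
proof -
  let ?J = "\<lambda>u. integral {x-1..u} f"
  have J: "(?J has_real_derivative f u) (at u)" if "x - 1 < u" "isCont f u" for u
  proof -
    have "(?J has_vector_derivative f u) (at u within ({x-1..u+1} - {}))"
      using li that unfolding locally_integrable_def
      by (intro integral_has_vector_derivative_continuous_at) (auto intro: continuous_at_imp_continuous_at_within)
    moreover have "at u within {x-1..u+1} = at u"
      using that by (intro at_within_interior) auto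
    ultimately show ?thesis by (simp add: has_real_derivative_iff_has_vector_derivative)
  qed
  have 1: "((\<lambda>y. ?J (y+1)) has_real_derivative f (x+1)) (at x)"
    using DERIV_shift[of ?J "f (x+1)" x 1] J[of "x+1"] assms by simp
  have "((\<lambda>y. ?J (y+1) - ?J y) has_real_derivative f (x+1) - f x) (at x)"
    by (intro derivative_intros 1 J assms) simp
  moreover have "\<forall>\<^sub>F y in nhds x. win f y = ?J (y+1) - ?J y"
  proof -
    have "\<forall>\<^sub>F y in nhds x. y \<in> {x-1<..}"
      by (intro eventually_nhds_in_open) auto
    then show ?thesis
    proof eventually_elim
      case (elim y)
      then have "integral {x-1..y} f + integral {y..y+1} f = integral {x-1..y+1} f"
        using li unfolding locally_integrable_def
        by (intro Henstock_Kurzweil_Integration.integral_combine) auto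
      then show ?case by (simp add: win_def)
    qed
  qed
  ultimately show ?thesis
    by (subst DERIV_cong_ev[OF refl _ refl]) auto
qed

text \<open>Moving the window changes the integral by the strip gained minus the strip lost, each of
  length \<open>\<bar>x - y\<bar>\<close>. No continuity of \<open>f\<close> enters.\<close>

lemma win_lipschitz:
  assumes li: "locally_integrable f" and B: "\<And>y. \<bar>f y\<bar> \<le> B"
  shows "\<bar>win f x - win f y\<bar> \<le> 2 * B * \<bar>x - y\<bar>"
proof -
  have *: "\<bar>win f y - win f x\<bar> \<le> 2 * B * (y - x)" if "x \<le> y" for x y
  proof -
    have i: "integral {x..x+1} f + integral {x+1..y+1} f = integral {x..y+1} f"
        "integral {x..y} f + integral {y..y+1} f = integral {x..y+1} f"
      using li that unfolding locally_integrable_def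
      by (intro Henstock_Kurzweil_Integration.integral_combine; auto)+
    have b: "\<bar>integral {a..b} f\<bar> \<le> B * (b - a)" if "a \<le> b" for a b
    proof -
      have "norm (integral {a..b} f) \<le> integral {a..b} (\<lambda>_. B)"
        using li B unfolding locally_integrable_def
        by (intro integral_norm_bound_integral) (auto simp: integrable_const_ivl)
      then show ?thesis using that by (simp add: mult.commute)
    qed
    have "win f y - win f x = integral {x+1..y+1} f - integral {x..y} f"
      using i by (simp add: win_def)
    moreover have "\<bar>integral {x+1..y+1} f\<bar> \<le> B * (y - x)" "\<bar>integral {x..y} f\<bar> \<le> B * (y - x)"
      using b[of "x+1" "y+1"] b[of x y] that by auto
    ultimately show ?thesis by linarith
  qed
  show ?thesis
  proof (cases "x \<le> y")
    case True
    then show ?thesis using *[OF True] by (simp add: abs_minus_commute)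
  next
    case False
    then show ?thesis using *[of y x] by simp
  qed
qed

lemma continuous_win:
  assumes "locally_integrable f" "\<And>y. \<bar>f y\<bar> \<le> B"
  shows "isCont (win f) x"
proof -
  have "((\<lambda>y. win f y - win f x) \<longlongrightarrow> 0) (at x)"
  proof (rule Lim_null_comparison)
    show "\<forall>\<^sub>F y in at x. norm (win f y - win f x) \<le> 2 * B * \<bar>y - x\<bar>"
      using win_lipschitz[OF assms] by auto
    show "((\<lambda>y. 2 * B * \<bar>y - x\<bar>) \<longlongrightarrow> 0) (at x)"
      by (auto intro!: tendsto_eq_intros)
  qed
  then show ?thesis by (simp add: isCont_def LIM_zero_iff)
qed

lemma win_dominated_convergence:
  assumes "\<And>k. locally_integrable (f k)" "\<And>k x. \<bar>f k x\<bar> \<le> B"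
    and "\<And>x. (\<lambda>k. f k x) \<longlonglongrightarrow> g x"
  shows "(\<lambda>k. win (f k) x) \<longlonglongrightarrow> win g x"
  unfolding win_def
  by (rule dominated_convergence[where h="\<lambda>_. B"])
     (use assms in \<open>auto simp: locally_integrable_def integrable_const_ivl\<close>)

section \<open>Limits of averages and translates at infinity\<close>

lemma win_tendsto_at_top:
  assumes "locally_integrable f" "(f \<longlongrightarrow> l) at_top"
  shows "(win f \<longlongrightarrow> l) at_top"
proof (rule tendstoI)
  fix e :: real assume "e > 0"
  then have "\<forall>\<^sub>F x in at_top. dist (f x) l < e / 2"
    using tendstoD[OF assms(2), of "e/2"] by simp
  then obtain N where N: "\<And>x. x \<ge> N \<Longrightarrow> dist (f x) l < e / 2"
    by (auto simp: eventually_at_top_linorder)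
  have N': "f x \<le> l + e / 2" "l - e / 2 \<le> f x" if "x \<ge> N" for x
    using N[OF that] unfolding dist_real_def by linarith+
  show "\<forall>\<^sub>F x in at_top. dist (win f x) l < e"
    unfolding eventually_at_top_linorder
  proof (intro exI[of _ N] allI impI)
    fix x assume xN: "x \<ge> N"
    have "win f x \<le> l + e / 2" by (rule win_le[OF assms(1) N'(1)]) (use xN in linarith)
    moreover have "l - e / 2 \<le> win f x" by (rule win_ge[OF assms(1) N'(2)]) (use xN in linarith)
    ultimately show "dist (win f x) l < e" using \<open>e > 0\<close> unfolding dist_real_def by linarith
  qed
qed

lemma win_tendsto_at_bot:
  assumes "locally_integrable f" "(f \<longlongrightarrow> l) at_bot"
  shows "(win f \<longlongrightarrow> l) at_bot"
proof (rule tendstoI)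
  fix e :: real assume "e > 0"
  then have "\<forall>\<^sub>F x in at_bot. dist (f x) l < e / 2"
    using tendstoD[OF assms(2), of "e/2"] by simp
  then obtain N where N: "\<And>x. x \<le> N \<Longrightarrow> dist (f x) l < e / 2"
    by (auto simp: eventually_at_bot_linorder)
  have N': "f x \<le> l + e / 2" "l - e / 2 \<le> f x" if "x \<le> N" for x
    using N[OF that] unfolding dist_real_def by linarith+
  show "\<forall>\<^sub>F x in at_bot. dist (win f x) l < e"
    unfolding eventually_at_bot_linorder
  proof (intro exI[of _ "N-1"] allI impI)
    fix x assume xN: "x \<le> N - 1"
    have "win f x \<le> l + e / 2" by (rule win_le[OF assms(1) N'(1)]) (use xN in linarith)
    moreover have "l - e / 2 \<le> win f x" by (rule win_ge[OF assms(1) N'(2)]) (use xN in linarith)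
    ultimately show "dist (win f x) l < e" using \<open>e > 0\<close> unfolding dist_real_def by linarith
  qed
qed

lemma shift_tendsto_at_top:
  fixes f :: "real \<Rightarrow> real"
  assumes "(f \<longlongrightarrow> l) at_top"
  shows "((\<lambda>x. f (x + c)) \<longlongrightarrow> l) at_top"
proof (rule filterlim_compose[OF assms])
  show "filterlim (\<lambda>x. x + c) at_top at_top"
    unfolding filterlim_at_top
  proof
    fix Z show "\<forall>\<^sub>F x in at_top. Z \<le> x + c"
      using eventually_ge_at_top[of "Z - c"] by eventually_elim linarith
  qed
qed

lemma shift_tendsto_at_bot:
  fixes f :: "real \<Rightarrow> real"
  assumes "(f \<longlongrightarrow> l) at_bot"
  shows "((\<lambda>x. f (x + c)) \<longlongrightarrow> l) at_bot"
proof (rule filterlim_compose[OF assms])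
  show "filterlim (\<lambda>x. x + c) at_bot at_bot"
    unfolding filterlim_at_bot
  proof
    fix Z show "\<forall>\<^sub>F x in at_bot. Z \<ge> x + c"
      using eventually_le_at_bot[of "Z - c"] by eventually_elim linarith
  qed
qed

section \<open>Jump conditions\<close>

lemma jump_condition:
  fixes F H :: "real \<Rightarrow> real"
  assumes F: "\<And>x. (F has_real_derivative F' x) (at x)"
    and eq: "\<And>x. s * F' x + H (x + 1) - H x = 0"
    and H: "continuous_on UNIV H"
    and lims: "(F \<longlongrightarrow> Fp) at_top" "(F \<longlongrightarrow> Fm) at_bot" "(H \<longlongrightarrow> Hp) at_top" "(H \<longlongrightarrow> Hm) at_bot"
  shows "s * (Fp - Fm) + (Hp - Hm) = 0"
proof -
  have li: "locally_integrable H" by (rule locally_integrable_continuous[OF H])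
  have cont: "isCont H x" for x using H by (simp add: continuous_on_eq_continuous_at)
  define c where "c = (\<lambda>x. s * F x + win H x)"
  have "(c has_real_derivative s * F' x + (H (x+1) - H x)) (at x)" for x
    unfolding c_def by (auto intro!: derivative_eq_intros F win_has_derivative li cont)
  moreover have "s * F' x + (H (x+1) - H x) = 0" for x using eq[of x] by simp
  ultimately have "(c has_real_derivative 0) (at x)" for x by metis
  then have c: "c x = c 0" for x using DERIV_isconst_all by blast
  have "(c \<longlongrightarrow> s * Fp + Hp) at_top" "(c \<longlongrightarrow> s * Fm + Hm) at_bot"
    unfolding c_def by (intro tendsto_intros lims win_tendsto_at_top win_tendsto_at_bot li)+
  moreover have "c = (\<lambda>_. c 0)" using c by auto
  ultimately have "((\<lambda>_. c 0) \<longlongrightarrow> s * Fp + Hp) (at_top::real filter)" "((\<lambda>_. c 0) \<longlongrightarrow> s * Fm + Hm) (at_bot::real filter)"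
    by metis+
  then have "c 0 = s * Fp + Hp" "c 0 = s * Fm + Hm"
    by (simp_all add: tendsto_const_iff)
  then show ?thesis by (simp add: algebra_simps)
qed

lemma front_imp_conservative_shock:
  assumes smooth: "smooth_fun \<Phi>" and front: "is_front \<Phi> \<sigma> rm vm rp vp R V"
  shows "conservative_shock \<Phi> \<sigma> rm vm rp vp"
proof -
  define \<phi> where "\<phi> = deriv \<Phi>"
  have d\<Phi>: "(\<Phi> has_real_derivative \<phi> x) (at x)" for x
    using smooth spec[of _ 0] unfolding smooth_fun_def \<phi>_def
    by (metis DERIV_deriv_iff_real_differentiable funpow_0)
  have "\<phi> differentiable (at x)" for x
    using smooth unfolding smooth_fun_def \<phi>_def
    by (metis funpow_0 funpow_simps_right(2) o_apply)
  then have \<phi>c: "isCont \<phi> x" for x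
    by (simp add: differentiable_imp_continuous_within)
  note fr = front[unfolded is_front_def C1_bounded_def, folded \<phi>_def]
  have dR: "(R has_real_derivative deriv R x) (at x)" and dV: "(V has_real_derivative deriv V x) (at x)" for x
    using fr by (auto simp: DERIV_deriv_iff_real_differentiable)
  have Rc: "isCont R x" and Vc: "isCont V x" for x
    using DERIV_isCont dR dV by blast+
  have lR: "(R \<longlongrightarrow> rp) at_top" "(R \<longlongrightarrow> rm) at_bot" and lV: "(V \<longlongrightarrow> vp) at_top" "(V \<longlongrightarrow> vm) at_bot"
    using fr by auto
  have e1: "\<sigma> * deriv R x + V (x + 1) - V x = 0"
    and e2: "\<sigma> * deriv V x + \<phi> (R x) - \<phi> (R (x - 1)) = 0" for x using fr by auto
  have lR': "((\<lambda>x. R (x - 1)) \<longlongrightarrow> rp) at_top" "((\<lambda>x. R (x - 1)) \<longlongrightarrow> rm) at_bot"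
    using shift_tendsto_at_top[OF lR(1), of "-1"] shift_tendsto_at_bot[OF lR(2), of "-1"] by auto
  have l\<phi>: "((\<lambda>x. \<phi> (R (x - 1))) \<longlongrightarrow> \<phi> rp) at_top" "((\<lambda>x. \<phi> (R (x - 1))) \<longlongrightarrow> \<phi> rm) at_bot"
    by (rule isCont_tendsto_compose[OF \<phi>c lR'(1)] isCont_tendsto_compose[OF \<phi>c lR'(2)])+
  have l\<Phi>: "((\<lambda>x. \<Phi> (R x)) \<longlongrightarrow> \<Phi> rp) at_top" "((\<lambda>x. \<Phi> (R x)) \<longlongrightarrow> \<Phi> rm) at_bot"
    by (rule isCont_tendsto_compose[OF DERIV_isCont[OF d\<Phi>] lR(1)] isCont_tendsto_compose[OF DERIV_isCont[OF d\<Phi>] lR(2)])+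
  have "isCont (\<lambda>x. R (x - 1)) x" for x
    by (rule isCont_o2[where f="\<lambda>x. x - 1", OF _ Rc]) simp
  then have \<phi>Rc: "isCont (\<lambda>x. \<phi> (R (x - 1))) x" for x
    by (rule isCont_o2[OF _ \<phi>c])
  have j1: "\<sigma> * (rp - rm) + (vp - vm) = 0"
    by (rule jump_condition[where F=R and H=V, OF dR e1 _ lR lV])
       (simp add: continuous_at_imp_continuous_on Vc)
  have j2: "\<sigma> * (vp - vm) + (\<phi> rp - \<phi> rm) = 0"
  proof (rule jump_condition[where F=V and H="\<lambda>x. \<phi> (R (x - 1))", OF dV _ _ lV l\<phi>])
    show "\<sigma> * deriv V x + \<phi> (R (x + 1 - 1)) - \<phi> (R (x - 1)) = 0" for x
      using e2[of x] by simp
  qed (simp add: continuous_at_imp_continuous_on \<phi>Rc)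
  have j3: "\<sigma> * ((vp\<^sup>2 / 2 + \<Phi> rp) - (vm\<^sup>2 / 2 + \<Phi> rm)) + (\<phi> rp * vp - \<phi> rm * vm) = 0"
  proof (rule jump_condition[where H="\<lambda>x. \<phi> (R (x - 1)) * V x" and F="\<lambda>x. (V x)\<^sup>2 / 2 + \<Phi> (R x)"])
    show "((\<lambda>x. (V x)\<^sup>2 / 2 + \<Phi> (R x)) has_real_derivative V x * deriv V x + \<phi> (R x) * deriv R x) (at x)" for x
      by (auto intro!: derivative_eq_intros dV dR DERIV_chain2[OF d\<Phi>])
    \<comment> \<open>Multiply the two wave equations by \<phi>(R x) and V x and add: the mixed
      terms \<phi>(R x) V x cancel, and what remains is the difference of the flux at x + 1 and
      x.\<close>
    show "\<sigma> * (V x * deriv V x + \<phi> (R x) * deriv R x) + \<phi> (R (x + 1 - 1)) * V (x + 1) - \<phi> (R (x - 1)) * V x = 0" for x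
    proof -
      have a: "\<sigma> * deriv R x = V x - V (x+1)" "\<sigma> * deriv V x = \<phi> (R (x-1)) - \<phi> (R x)"
        using e1[of x] e2[of x] by auto
      have "\<sigma> * (V x * deriv V x + \<phi> (R x) * deriv R x) = V x * (\<sigma> * deriv V x) + \<phi> (R x) * (\<sigma> * deriv R x)"
        by (simp add: algebra_simps)
      then show ?thesis unfolding a by (simp add: algebra_simps)
    qed
    show "continuous_on UNIV (\<lambda>x. \<phi> (R (x - 1)) * V x)"
      using \<phi>Rc Vc by (auto intro!: continuous_at_imp_continuous_on isCont_mult)
  qed (auto intro!: tendsto_add tendsto_divide tendsto_power tendsto_mult tendsto_const lV l\<Phi> l\<phi>)
  show ?thesis
    using j1 j2 j3 by (simp add: conservative_shock_def jump_def \<phi>_def)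
qed

section \<open>Monotone profiles\<close>

text \<open>Continuity is not demanded, because the truncations below may jump. Monotonicity alone
  gives integrability and survives pointwise limits.\<close>

definition profile :: "(real \<Rightarrow> real) \<Rightarrow> bool" where
  "profile P \<longleftrightarrow> mono P \<and> (\<forall>x. \<bar>P x\<bar> \<le> 1)"

text \<open>The window lies to the left here and to the right in \<open>strain\<close>, matching the
  delayed and the advanced difference of the wave equations. Together they average against the tent
  kernel on [x - 1, x + 1].\<close>

definition vel :: "(real \<Rightarrow> real) \<Rightarrow> real \<Rightarrow> real" where
  "vel P x = win P (x - 1)"

definition strain :: "(real \<Rightarrow> real) \<Rightarrow> real \<Rightarrow> real" where
  "strain P = win (vel P)"

text \<open>This is the flux of the energy identity for fronts, with \<open>P\<close> in place of
  \<Phi>' composed with R and \<open>vel P\<close> in place of V.\<close>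

definition flux :: "(real \<Rightarrow> real) \<Rightarrow> real \<Rightarrow> real" where
  "flux P x = vel P x * P (x - 1)"

lemma profileD:
  assumes "profile P"
  shows "mono P" "\<bar>P x\<bar> \<le> 1" "P x \<le> 1" "-1 \<le> P x" "x \<le> y \<Longrightarrow> P x \<le> P y" "locally_integrable P"
proof -
  show "mono P" "\<bar>P x\<bar> \<le> 1" using assms by (auto simp: profile_def)
  then show "P x \<le> 1" "-1 \<le> P x" "x \<le> y \<Longrightarrow> P x \<le> P y" "locally_integrable P"
    by (auto dest: monoD intro: locally_integrable_mono)
qed

lemma profile_shift:
  assumes "profile P" shows "profile (\<lambda>x. P (x + s))"
  using assms profileD(2,5)[OF assms] by (simp add: profile_def mono_def)

lemma profile_win:
  assumes "profile P" shows "profile (win P)"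
  unfolding profile_def using profileD[OF assms] by (auto intro: mono_win win_abs_le)

lemma vel_eq: "vel P = win (\<lambda>y. P (y + (-1)))"
  unfolding win_shift vel_def by (rule ext) simp

lemma profile_vel: "profile P \<Longrightarrow> profile (vel P)"
  unfolding vel_eq by (rule profile_win[OF profile_shift])

lemma profile_strain: "profile P \<Longrightarrow> profile (strain P)"
  unfolding strain_def by (rule profile_win[OF profile_vel])

lemma isCont_win_profile: "profile P \<Longrightarrow> isCont (win P) x"
  by (rule continuous_win[OF profileD(6) profileD(2)])

lemma isCont_vel: "profile P \<Longrightarrow> isCont (vel P) x"
  unfolding vel_eq by (rule isCont_win_profile[OF profile_shift])

lemma isCont_strain: "profile P \<Longrightarrow> isCont (strain P) x"
  unfolding strain_def by (rule isCont_win_profile[OF profile_vel])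

text \<open>The constant is the same for all profiles, which supplies the equicontinuity for
  extracting a subsequence.\<close>

lemma strain_lipschitz:
  assumes "profile P" shows "\<bar>strain P x - strain P y\<bar> \<le> 2 * \<bar>x - y\<bar>"
  using win_lipschitz[OF profileD(6) profileD(2), OF profile_vel[OF assms] profile_vel[OF assms]]
  by (simp add: strain_def)

lemma vel_has_derivative:
  assumes "profile P" "isCont P x" "isCont P (x - 1)"
  shows "(vel P has_real_derivative P x - P (x - 1)) (at x)"
proof -
  have "(win P has_real_derivative P x - P (x - 1)) (at (x + (-1)))"
    using win_has_derivative[OF profileD(6)[OF assms(1)], of "x - 1"] assms(2,3) by simp
  from this[unfolded DERIV_shift] show ?thesis unfolding vel_def by simp
qed

lemma strain_has_derivative:
  assumes "profile P"
  shows "(strain P has_real_derivative vel P (x + 1) - vel P x) (at x)"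
  unfolding strain_def
  by (intro win_has_derivative profileD(6) isCont_vel profile_vel assms)

lemma vel_shift: "vel (\<lambda>y. P (y + s)) x = vel P (x + s)"
  unfolding vel_def win_shift by (simp add: algebra_simps)

lemma strain_shift: "strain (\<lambda>y. P (y + s)) x = strain P (x + s)"
  unfolding strain_def vel_shift win_shift ..

lemma flux_shift: "flux (\<lambda>y. P (y + s)) x = flux P (x + s)"
  unfolding flux_def vel_shift by (simp add: algebra_simps)

lemma abs_mult_le_1: "\<bar>a\<bar> \<le> 1 \<Longrightarrow> \<bar>b\<bar> \<le> 1 \<Longrightarrow> \<bar>a * b\<bar> \<le> (1::real)"
  using mult_mono[of "\<bar>a\<bar>" 1 "\<bar>b\<bar>" 1] by (simp add: abs_mult)

lemma flux_bound: "profile P \<Longrightarrow> \<bar>flux P x\<bar> \<le> 1"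
  unfolding flux_def by (intro abs_mult_le_1 profileD(2) profile_vel)

lemma flux_locally_integrable:
  assumes "profile P" shows "locally_integrable (flux P)"
proof -
  have 1: "profile (\<lambda>y. P (y + (-1)))" by (rule profile_shift[OF assms])
  have "locally_integrable (\<lambda>x. vel P x * P (x + (-1)))"
    by (rule locally_integrable_mult_mono[OF profileD(1) profileD(1) profileD(2) profileD(2)])
       (rule profile_vel[OF assms] 1)+
  then show ?thesis by (simp add: flux_def[abs_def])
qed

section \<open>Pointwise limits and comparison of profiles\<close>

lemma profile_limit:
  assumes "\<And>k. profile (P k)" "\<And>x. (\<lambda>k. P k x) \<longlonglongrightarrow> Q x"
  shows "profile Q"
  unfolding profile_def
proof (intro conjI allI monoI)
  fix x y :: real assume "x \<le> y"
  then show "Q x \<le> Q y"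
    by (intro LIMSEQ_le[OF assms(2)[of x] assms(2)[of y]]) (auto intro: profileD(5)[OF assms(1)])
next
  fix x show "\<bar>Q x\<bar> \<le> 1"
    using tendsto_rabs[OF assms(2)[of x]] by (rule LIMSEQ_le_const2) (auto intro: profileD(2)[OF assms(1)])
qed

lemma vel_limit:
  assumes "\<And>k. profile (P k)" "\<And>x. (\<lambda>k. P k x) \<longlonglongrightarrow> Q x"
  shows "(\<lambda>k. vel (P k) x) \<longlonglongrightarrow> vel Q x"
  unfolding vel_def
  by (rule win_dominated_convergence[OF profileD(6) profileD(2)]) (rule assms)+

lemma strain_limit:
  assumes "\<And>k. profile (P k)" "\<And>x. (\<lambda>k. P k x) \<longlonglongrightarrow> Q x"
  shows "(\<lambda>k. strain (P k) x) \<longlonglongrightarrow> strain Q x"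
  unfolding strain_def
  by (rule win_dominated_convergence[OF profileD(6) profileD(2)]) (rule profile_vel vel_limit assms)+

lemma flux_limit:
  assumes "\<And>k. profile (P k)" "\<And>x. (\<lambda>k. P k x) \<longlonglongrightarrow> Q x"
  shows "(\<lambda>k. win (flux (P k)) x) \<longlonglongrightarrow> win (flux Q) x"
proof (rule win_dominated_convergence[OF flux_locally_integrable flux_bound])
  show "(\<lambda>k. flux (P k) x) \<longlonglongrightarrow> flux Q x" for x
    unfolding flux_def by (intro tendsto_mult vel_limit assms)
qed (rule assms)+

text \<open>This order preservation drives the monotone iteration for the truncated problem.\<close>

lemma strain_mono_arg:
  assumes "profile P" "profile Q" "\<And>x. P x \<le> Q x"
  shows "strain P x \<le> strain Q x"
  unfolding strain_def
proof (rule win_mono_at)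
  show "vel P y \<le> vel Q y" for y
    unfolding vel_def by (rule win_mono_at) (use assms profileD(6) in auto)
qed (use assms profileD(6) profile_vel in auto)

section \<open>Normalised potentials and approximate waves\<close>

text \<open>The primitive \<open>F\<close> of \<open>\<Psi>\<close> plays the role of the normalised potential, and \<open>area\<close> is the
  condition \<open>g > 0\<close>. The bound \<open>K\<close> lets the energy control the defect of approximate waves.\<close>

locale normalised_potential =
  fixes F \<Psi> \<Psi>' :: "real \<Rightarrow> real" and K :: real
  assumes F_deriv: "\<And>w. (F has_real_derivative \<Psi> w) (at w)"
    and Psi_deriv: "\<And>w. (\<Psi> has_real_derivative \<Psi>' w) (at w)"
    and Psi_mono: "mono \<Psi>"
    and Psi_1: "\<Psi> 1 = 1" and Psi_m1: "\<Psi> (-1) = -1"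
    and F_ends: "F (-1) = F 1"
    and K: "\<And>w. \<bar>w\<bar> \<le> 1 \<Longrightarrow> \<bar>\<Psi>' w\<bar> \<le> K"
    and area: "\<And>w. -1 < w \<Longrightarrow> w < 1 \<Longrightarrow> 1/2 - F 1 < w\<^sup>2/2 - F w"
begin

text \<open>Because F(-1) = F 1, this is the value of \<open>w\<^sup>2 / 2 - F w\<close> at both end
  states.\<close>

definition e0 :: real where "e0 = 1/2 - F 1"

text \<open>For \<open>P = \<Psi> \<circ> strain P\<close> this is the local form of the third jump condition: it is constant along the
  wave and equals \<open>w\<^sup>2 / 2 - F w\<close> at an asymptotic state \<open>w\<close>.\<close>

definition energy :: "(real \<Rightarrow> real) \<Rightarrow> real \<Rightarrow> real" where
  "energy P x = win (flux P) x - (vel P x)\<^sup>2 / 2 - F (strain P x)"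

lemma K_nonneg: "0 \<le> K"
  using K[of 1] by simp

lemma Psi_isCont: "isCont \<Psi> w" and F_isCont: "isCont F w"
  using DERIV_isCont Psi_deriv F_deriv by blast+

lemma Psi_bounds:
  assumes "\<bar>w\<bar> \<le> 1" shows "\<Psi> w \<le> 1" "-1 \<le> \<Psi> w" "\<bar>\<Psi> w\<bar> \<le> 1"
proof -
  show "\<Psi> w \<le> 1" "-1 \<le> \<Psi> w"
    using monoD[OF Psi_mono, of w 1] monoD[OF Psi_mono, of "-1" w] assms by (auto simp: Psi_1 Psi_m1)
  then show "\<bar>\<Psi> w\<bar> \<le> 1" by simp
qed

lemma area_le:
  assumes "\<bar>w\<bar> \<le> 1" shows "e0 \<le> w\<^sup>2/2 - F w"
proof (cases "w = 1 \<or> w = -1")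
  case True then show ?thesis by (auto simp: e0_def F_ends)
next
  case False
  then have "-1 < w" "w < 1" using assms by auto
  from area[OF this] show ?thesis by (simp add: e0_def)
qed

lemma energy_shift: "energy (\<lambda>y. P (y + s)) x = energy P (x + s)"
  unfolding energy_def vel_shift strain_shift flux_shift win_shift ..

text \<open>Only window averages enter, so the energy is continuous even where \<open>P\<close>
  jumps. Monotonicity on adjacent pieces can therefore be joined across the jumps.\<close>

lemma isCont_energy:
  assumes "profile P" shows "isCont (energy P) x"
  unfolding energy_def[abs_def]
  by (intro isCont_diff isCont_divide isCont_power isCont_vel assms
      continuous_win[OF flux_locally_integrable flux_bound] isCont_o2[OF isCont_strain F_isCont]) simp_all

text \<open>The terms in \<open>P (x - 1)\<close> from the flux and from the squared velocity
  cancel. Since \<open>vel P\<close> is nondecreasing, the sign of the derivative is governed by the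
  defect \<open>P x - \<Psi> (strain P x)\<close>.\<close>

lemma energy_has_derivative:
  assumes "profile P" "isCont P x" "isCont P (x - 1)"
  shows "(energy P has_real_derivative (P x - \<Psi> (strain P x)) * (vel P (x + 1) - vel P x)) (at x)"
proof -
  have c: "isCont (flux P) x" "isCont (flux P) (x + 1)"
  proof -
    have "isCont (\<lambda>y. P (y - 1)) z" if "isCont P (z - 1)" for z
      by (rule isCont_o2[where f="\<lambda>y. y - 1", OF _ that]) simp
    then show "isCont (flux P) x" "isCont (flux P) (x + 1)"
      unfolding flux_def[abs_def] using assms by (simp_all add: isCont_mult isCont_vel)
  qed
  have "(energy P has_real_derivative (flux P (x + 1) - flux P x)
      - vel P x * (P x - P (x - 1)) - \<Psi> (strain P x) * (vel P (x + 1) - vel P x)) (at x)"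
    unfolding energy_def[abs_def]
    by (rule derivative_eq_intros win_has_derivative[OF flux_locally_integrable[OF assms(1)] c]
        vel_has_derivative[OF assms] DERIV_chain2[OF F_deriv strain_has_derivative[OF assms(1)]] refl | simp)+
  then show ?thesis by (simp add: flux_def algebra_simps)
qed

lemma energy_limit:
  assumes "\<And>k. profile (P k)" "\<And>x. (\<lambda>k. P k x) \<longlonglongrightarrow> Q x"
  shows "(\<lambda>k. energy (P k) x) \<longlonglongrightarrow> energy Q x"
  unfolding energy_def
  by (intro tendsto_diff tendsto_divide tendsto_power vel_limit flux_limit tendsto_const
      isCont_tendsto_compose[OF F_isCont] strain_limit assms) simp_all

section \<open>The truncated problem on a finite interval\<close>

definition truncate :: "real \<Rightarrow> (real \<Rightarrow> real) \<Rightarrow> real \<Rightarrow> real" where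
  "truncate L Q x = (if x < -L then -1 else if x < L then \<Psi> (Q x) else 1)"

lemma profile_truncate:
  assumes "profile Q" shows "profile (truncate L Q)"
  unfolding profile_def
proof (intro conjI allI monoI)
  show "\<bar>truncate L Q x\<bar> \<le> 1" for x
    using Psi_bounds(3)[OF profileD(2)[OF assms]] by (simp add: truncate_def)
  fix x y :: real assume "x \<le> y"
  moreover have "\<Psi> (Q x) \<le> \<Psi> (Q y)"
    using \<open>x \<le> y\<close> by (intro monoD[OF Psi_mono] profileD(5)[OF assms])
  moreover have "-1 \<le> \<Psi> (Q z)" "\<Psi> (Q z) \<le> 1" for z
    by (intro Psi_bounds profileD(2)[OF assms])+
  ultimately show "truncate L Q x \<le> truncate L Q y"
    by (auto simp: truncate_def)
qed

text \<open>The map taking \<open>Q\<close> to \<open>truncate L (strain Q)\<close> preserves order,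
  since averaging and \<Psi> do. Its iterates decrease pointwise, and dominated convergence with
  continuity of \<Psi> makes the limit a fixed point.\<close>

lemma truncated_fixed_point:
  obtains P where "profile P" "P = truncate L (strain P)"
proof -
  \<comment> \<open>The start is the largest profile that equals -1 left of -L, so the first iterate
    lies below it.\<close>
  define P where "P = (\<lambda>k. ((\<lambda>Q. truncate L (strain Q)) ^^ k) (\<lambda>x. if x < -L then -1 else 1))"
  have Suc: "P (Suc k) = truncate L (strain (P k))" for k by (simp add: P_def)
  have P: "profile (P k)" for k
  proof (induction k)
    case 0 then show ?case by (auto simp: P_def profile_def mono_def)
  next
    case (Suc k) then show ?case by (simp add: \<open>P (Suc k) = _\<close> profile_truncate profile_strain)
  qed
  have dec: "P (Suc k) x \<le> P k x" for k x
  proof (induction k arbitrary: x)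
    case 0 then show ?case
      using profileD(3)[OF P, of 1 x] by (auto simp: Suc[of 0] truncate_def P_def)
  next
    case IH: (Suc k)
    have "strain (P (Suc k)) x \<le> strain (P k) x" by (intro strain_mono_arg P IH)
    then have "\<Psi> (strain (P (Suc k)) x) \<le> \<Psi> (strain (P k) x)" by (rule monoD[OF Psi_mono])
    then show ?case unfolding Suc[of "Suc k"] Suc[of k] by (simp add: truncate_def)
  qed
  have "\<exists>l. (\<lambda>k. P k x) \<longlonglongrightarrow> l" for x
  proof -
    have "decseq (\<lambda>k. P k x)" using dec by (simp add: decseq_Suc_iff)
    moreover have "\<forall>k. -1 \<le> P k x" using profileD(4)[OF P] by blast
    ultimately show ?thesis by (metis decseq_convergent)
  qed
  then obtain Q where Q: "\<And>x. (\<lambda>k. P k x) \<longlonglongrightarrow> Q x" by metis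
  have "(\<lambda>k. P (Suc k) x) \<longlonglongrightarrow> truncate L (strain Q) x" for x
    unfolding Suc truncate_def using isCont_tendsto_compose[OF Psi_isCont strain_limit[OF P Q]] by simp
  then have "Q x = truncate L (strain Q) x" for x
    using LIMSEQ_unique[OF LIMSEQ_Suc[OF Q]] by blast
  then show thesis by (intro that[of Q] profile_limit[OF P Q] ext)
qed

end

context normalised_potential
begin

text \<open>Here L = n. The energy loss is at most 3 \<epsilon> with \<epsilon> = 2 / n, and the
  squared defect is at most 2 K times the loss. The normalisation at 0 keeps the front from drifting
  away in the limit.\<close>

lemma truncated_solution:
  fixes n :: nat
  assumes n: "n \<ge> 1"
  obtains P where "profile P" "strain P 0 = 0"
    "\<And>x. energy P x \<le> e0" "\<And>x. e0 - 6 / n \<le> energy P x"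
    "\<And>x. (P x - \<Psi> (strain P x))\<^sup>2 \<le> 12 * K / n"
proof -
  define L where "L = real n"
  have L: "L \<ge> 1" using n by (simp add: L_def)
  obtain P where P: "profile P" and fixP: "P = truncate L (strain P)"
    by (rule truncated_fixed_point)
  define U where "U = strain P"
  define V where "V = vel P"
  define E where "E = energy P"
  note Pb = profileD(2-5)[OF P]
  have U: "profile U" and V: "profile V" by (simp_all add: U_def V_def profile_strain profile_vel P)
  note Ub = profileD(2-5)[OF U] and Vb = profileD(2-5)[OF V]
  have left: "P x = -1" if "x < -L" for x
    by (subst fixP) (use that in \<open>simp add: truncate_def\<close>)
  have mid: "P x = \<Psi> (U x)" if "-L \<le> x" "x < L" for x
    by (subst fixP) (use that in \<open>simp add: truncate_def U_def\<close>)
  have right: "P x = 1" if "L \<le> x" for x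
    by (subst fixP) (use that L in \<open>simp add: truncate_def\<close>)
  have cont: "isCont P x" if "x \<noteq> -L" "x \<noteq> L" for x
  proof -
    have "isCont (\<lambda>x. \<Psi> (U x)) x"
      unfolding U_def by (rule isCont_o2[OF isCont_strain[OF P] Psi_isCont])
    moreover have "\<forall>\<^sub>F y in nhds x. P y = \<Psi> (U y)" if "x \<in> {-L<..<L}"
      using eventually_nhds_in_open[OF open_greaterThanLessThan that] by eventually_elim (use mid in auto)
    moreover have "\<forall>\<^sub>F y in nhds x. P y = -1" if "x \<in> {..<-L}"
      using eventually_nhds_in_open[OF open_lessThan that] by eventually_elim (use left in auto)
    moreover have "\<forall>\<^sub>F y in nhds x. P y = 1" if "x \<in> {L<..}"
      using eventually_nhds_in_open[OF open_greaterThan that] by eventually_elim (use right in auto)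
    ultimately show ?thesis
      using that L by (cases "x < -L"; cases "x < L") (auto simp: isCont_cong)
  qed
  have E_cont: "isCont E x" for x unfolding E_def by (rule isCont_energy[OF P])
  then have E_con: "continuous_on S E" for S by (simp add: continuous_at_imp_continuous_on)
  have dU: "(U has_real_derivative V (x + 1) - V x) (at x)" for x
    unfolding U_def V_def by (rule strain_has_derivative[OF P])
  \<comment> \<open>The derivative involves \<open>P\<close> at x and at x - 1, so each of the two
    possible jumps of \<open>P\<close> excludes two points.\<close>
  have dE: "(E has_real_derivative (P x - \<Psi> (U x)) * (V (x + 1) - V x)) (at x)"
    if "x \<noteq> -L" "x \<noteq> L" "x \<noteq> 1 - L" "x \<noteq> 1 + L" for x
    unfolding E_def U_def V_def by (rule energy_has_derivative[OF P cont cont]) (use that in auto)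
  have V_inc: "0 \<le> V (x + 1) - V x" for x using Vb(4)[of x "x+1"] by simp
  have \<Psi>U: "-1 \<le> \<Psi> (U x)" "\<Psi> (U x) \<le> 1" for x by (intro Psi_bounds Ub)+

  \<comment> \<open>The energy and strain at x see \<open>P\<close> only on [x - 1, x + 1]. The
    margin 2 keeps this interval strictly left of -L, where \<open>P\<close> already takes its
    middle value.\<close>
  have far_left: "U x = -1" "E x = e0" if "x \<le> -L - 2" for x
  proof -
    have V1: "V y = -1" if "y < -L" for y
      unfolding V_def vel_def by (rule win_const_on) (use that left in auto)
    then show U1: "U x = -1"
      unfolding U_def strain_def V_def[symmetric] by (intro win_const_on V1) (use that in auto)
    have "win (flux P) x = 1"
      by (rule win_const_on) (use that in \<open>auto simp: flux_def V_def[symmetric] V1 left\<close>)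
    then show "E x = e0"
      using U1 V1[of x] that by (simp add: E_def energy_def U_def[symmetric] V_def[symmetric] e0_def F_ends)
  qed
  have far_right: "U x = 1" "E x = e0" if "x \<ge> L + 1" for x
  proof -
    have V1: "V y = 1" if "y \<ge> L + 1" for y
      unfolding V_def vel_def by (rule win_const_on) (use that right in auto)
    then show U1: "U x = 1"
      unfolding U_def strain_def V_def[symmetric] by (intro win_const_on V1) (use that in auto)
    have "win (flux P) x = 1"
      by (rule win_const_on) (use that in \<open>auto simp: flux_def V_def[symmetric] V1 right\<close>)
    then show "E x = e0"
      using U1 V1[of x] that by (simp add: E_def energy_def U_def[symmetric] V_def[symmetric] e0_def)
  qed
  have E_left: "E b \<le> E a" if "a \<le> b" "b \<le> -L" for a b
  proof (rule DERIV_nonpos_imp_decreasing_open[OF that(1) _ E_con])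
    fix x assume "a < x" "x < b"
    then have "x < -L" using that by simp
    then have "(P x - \<Psi> (U x)) * (V (x + 1) - V x) \<le> 0"
      using left[of x] \<Psi>U(1)[of x] V_inc[of x] by (intro mult_nonpos_nonneg) auto
    then show "\<exists>y. (E has_real_derivative y) (at x) \<and> y \<le> 0"
      using dE[of x] \<open>x < -L\<close> L by (intro exI conjI) auto
  qed
  \<comment> \<open>The range stops at L + 1, where the jump at L reappears through
    \<open>P (x - 1)\<close>; from there on the energy equals \<open>e0\<close>.\<close>
  have E_right: "E a \<le> E b" if "a \<le> b" "L \<le> a" "b \<le> L + 1" for a b
  proof (rule DERIV_nonneg_imp_increasing_open[OF that(1) _ E_con])
    fix x assume x: "a < x" "x < b"
    then have "0 \<le> (P x - \<Psi> (U x)) * (V (x + 1) - V x)"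
      using that right[of x] \<Psi>U(2)[of x] V_inc[of x] by (intro mult_nonneg_nonneg) auto
    then show "\<exists>y. (E has_real_derivative y) (at x) \<and> 0 \<le> y"
      using dE[of x] x that L by (intro exI conjI) auto
  qed
  \<comment> \<open>The jump at -L reappears at 1 - L, which must not be an interior point.
    \<open>E_mid\<close> joins the two sides.\<close>
  have E_const: "E b = E a" if "a \<le> b" "-L \<le> a" "b \<le> L" "b \<le> 1 - L \<or> 1 - L \<le> a" for a b
  proof -
    have D0: "(E has_real_derivative 0) (at x)" if x: "a < x" "x < b" for x
      using dE[of x] mid[of x] x that \<open>-L \<le> a\<close> \<open>b \<le> L\<close> \<open>b \<le> 1 - L \<or> _\<close> by auto
    have "E a \<le> E b" "E b \<le> E a"
      by (rule DERIV_nonneg_imp_increasing_open[OF that(1) _ E_con]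
          DERIV_nonpos_imp_decreasing_open[OF that(1) _ E_con]; use D0 in blast)+
    then show ?thesis by simp
  qed
  have E_mid: "E x = E (-L)" if "-L \<le> x" "x \<le> L" for x
    using E_const[of "-L" x] E_const[of "-L" "1 - L"] E_const[of "1 - L" x] that L
    by (cases "x \<le> 1 - L") auto

  txt \<open>By pigeonhole \<open>P\<close> is almost constant on some window of length 2 inside \<open>[-L, L]\<close>. There the energy is
    close to \<open>u\<^sup>2 / 2 - F u\<close>, hence by the area condition the plateau value of \<open>E\<close> is almost \<open>e0\<close>.\<close>
  define \<epsilon> where "\<epsilon> = 2 / L"
  have "\<epsilon> \<ge> 0" using L by (simp add: \<epsilon>_def)
  define a where "a = (\<lambda>k. P (2 * real k - L))"
  \<comment> \<open>The n windows of length 2 tile [-L, L], and \<open>P\<close> rises by at most 2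
    over all of them, so the mean increment is at most 2 / n.\<close>
  have "\<exists>k<n. a (Suc k) - a k \<le> \<epsilon>"
  proof (rule ccontr)
    assume "\<not> ?thesis"
    then have "(\<Sum>k<n. \<epsilon>) < (\<Sum>k<n. a (Suc k) - a k)"
      using n by (intro sum_strict_mono) (auto simp: not_le lessThan_empty_iff)
    also have "\<dots> = a n - a 0" by (rule sum_lessThan_telescope)
    also have "\<dots> \<le> 2" using Pb(2,3)[of "2 * real n - L"] Pb(2,3)[of "-L"] by (simp add: a_def)
    finally show False using L by (simp add: \<epsilon>_def L_def)
  qed
  then obtain k where k: "k < n" "a (Suc k) - a k \<le> \<epsilon>" by blast
  \<comment> \<open>The centre of the window: the energy there depends on \<open>P\<close> only
    inside the window.\<close>
  define x0 where "x0 = 2 * real k - L + 1"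
  have "real k + 1 \<le> L" using k(1) unfolding L_def by linarith
  then have x0: "-L \<le> x0" "x0 \<le> L" by (simp_all add: x0_def)
  define p where "p = P (x0 - 1)"
  define u where "u = U x0"
  have P_win: "p \<le> P y" "P y \<le> p + \<epsilon>" if "x0 - 1 \<le> y" "y \<le> x0 + 1" for y
  proof -
    have "p = a k" "P (x0 + 1) = a (Suc k)"
      by (simp_all add: a_def p_def x0_def algebra_simps)
    then show "p \<le> P y" "P y \<le> p + \<epsilon>"
      using Pb(4)[OF that(1)] Pb(4)[OF that(2)] k(2) by (auto simp: p_def)
  qed
  have V_win: "p \<le> V y" "V y \<le> p + \<epsilon>" if "x0 \<le> y" "y \<le> x0 + 1" for y
    unfolding V_def vel_def
    by (rule win_ge win_le, rule profileD(6)[OF P], rule P_win; use that in simp)+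
  have u: "p \<le> u" "u \<le> p + \<epsilon>"
    unfolding u_def U_def strain_def V_def[symmetric]
    by (rule win_ge win_le, rule profileD(6)[OF V], rule V_win; simp)+
  have u1: "\<bar>u\<bar> \<le> 1" unfolding u_def by (rule Ub)
  have sq: "\<bar>v * q - u * u\<bar> \<le> 2 * \<epsilon>"
    if "\<bar>v\<bar> \<le> 1" "p \<le> v" "v \<le> p + \<epsilon>" "p \<le> q" "q \<le> p + \<epsilon>" for v q
  proof -
    have "\<bar>v * (q - u)\<bar> \<le> 1 * \<epsilon>" "\<bar>u * (v - u)\<bar> \<le> 1 * \<epsilon>"
      unfolding abs_mult using that u u1 by (intro mult_mono; simp)+
    moreover have "v * q - u * u = v * (q - u) + u * (v - u)" by (simp add: algebra_simps)
    ultimately show ?thesis by linarith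
  qed
  have "u * u - 2 * \<epsilon> \<le> win (flux P) x0"
  proof (rule win_ge[OF flux_locally_integrable[OF P]])
    fix y assume y: "x0 \<le> y" "y \<le> x0 + 1"
    have "\<bar>V y * P (y - 1) - u * u\<bar> \<le> 2 * \<epsilon>"
      by (intro sq V_win P_win Vb) (use y in auto)
    then show "u * u - 2 * \<epsilon> \<le> flux P y" by (simp add: flux_def V_def abs_le_iff)
  qed
  moreover have "\<bar>V x0 * V x0 - u * u\<bar> \<le> 2 * \<epsilon>"
    by (intro sq V_win Vb) auto
  moreover have "e0 \<le> u\<^sup>2/2 - F u" by (rule area_le[OF u1])
  moreover have "E x0 = win (flux P) x0 - V x0 * V x0 / 2 - F u"
    by (simp add: E_def energy_def V_def u_def U_def power2_eq_square)
  \<comment> \<open>The flux term costs 2 \<epsilon>, and half the squared velocity costs another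
    \<epsilon>.\<close>
  ultimately have "e0 - 3 * \<epsilon> \<le> E x0" unfolding power2_eq_square by (simp add: abs_le_iff)
  then have E_low_mid: "e0 - 3 * \<epsilon> \<le> E x" if "-L \<le> x" "x \<le> L" for x
    using E_mid[OF that] E_mid[OF x0] by simp
  have left_bounds: "E x \<le> e0" "e0 - 3 * \<epsilon> \<le> E x" if "x \<le> -L" for x
  proof -
    show "E x \<le> e0"
      using E_left[of "min x (-L-2)" x] far_left(2)[of "min x (-L-2)"] that by simp
    show "e0 - 3 * \<epsilon> \<le> E x" using E_left[of x "-L"] E_low_mid[of "-L"] that L by simp
  qed
  have right_bounds: "E x \<le> e0" "e0 - 3 * \<epsilon> \<le> E x" if "x \<ge> L" for x
  proof -
    have "E x \<le> e0 \<and> e0 - 3 * \<epsilon> \<le> E x"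
    proof (cases "x \<le> L + 1")
      case True
      then show ?thesis
        using E_right[of x "L+1"] far_right(2)[of "L+1"] E_right[of L x] E_low_mid[of L] that L by simp
    next
      case False
      then show ?thesis using far_right(2)[of x] \<open>\<epsilon> \<ge> 0\<close> by simp
    qed
    then show "E x \<le> e0" "e0 - 3 * \<epsilon> \<le> E x" by auto
  qed
  have E_bounds: "E x \<le> e0" "e0 - 3 * \<epsilon> \<le> E x" for x
  proof -
    consider "x \<le> -L" | "L \<le> x" | "-L \<le> x" "x \<le> L" by linarith
    then have "E x \<le> e0 \<and> e0 - 3 * \<epsilon> \<le> E x"
    proof cases
      case 1 then show ?thesis using left_bounds[of x] by blast
    next
      case 2 then show ?thesis using right_bounds[of x] by blast
    next
      case 3 then show ?thesis using E_low_mid[of x] E_mid[of x] left_bounds(1)[of "-L"] by simp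
    qed
    then show "E x \<le> e0" "e0 - 3 * \<epsilon> \<le> E x" by auto
  qed

  have d\<Psi>U: "((\<lambda>x. \<Psi> (U x)) has_real_derivative \<Psi>' (U x) * (V (x + 1) - V x)) (at x)" for x
    by (rule DERIV_chain2[OF Psi_deriv dU])
  have \<Psi>U_con: "continuous_on S (\<lambda>x. \<Psi> (U x))" for S
    using DERIV_isCont[OF d\<Psi>U] by (simp add: continuous_at_imp_continuous_on)
  have \<Psi>'U: "\<Psi>' (U x) \<le> K" for x using K[OF Ub(1)[of x]] by simp
  \<comment> \<open>In the outer regions the rate of change of half the squared defect is controlled
    by K times that of the energy, because \<Psi>' is at most K. Hence \<open>D\<close> is monotone
    towards the zone where the defect vanishes and the energy is \<open>e0\<close>; comparing with
    that zone gives the bound.\<close>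
  have defect: "(P x - \<Psi> (U x))\<^sup>2 \<le> 2 * (K * (e0 - E x))" for x
  proof -
    consider "x < -L" | "-L \<le> x" "x < L" | "L \<le> x" "x \<le> L + 1" | "L + 1 < x" by linarith
    then show ?thesis
    proof cases
      case 1
      define D where "D = (\<lambda>x. (\<Psi> (U x) + 1)\<^sup>2 / 2 + K * E x)"
      define x1 where "x1 = min x (-L - 2)"
      have "D x \<le> D x1"
      proof (rule DERIV_nonpos_imp_decreasing_open[where f=D])
        fix z assume "x1 < z" "z < x"
        then have z: "z < -L" using 1 by simp
        have "(D has_real_derivative (\<Psi> (U z) + 1) * (\<Psi>' (U z) * (V (z + 1) - V z))
            + K * ((P z - \<Psi> (U z)) * (V (z + 1) - V z))) (at z)"
          unfolding D_def using z L
          by (auto intro!: derivative_eq_intros d\<Psi>U dE)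
        moreover have "(\<Psi> (U z) + 1) * (\<Psi>' (U z) * (V (z + 1) - V z))
            + K * ((P z - \<Psi> (U z)) * (V (z + 1) - V z))
          = - ((\<Psi> (U z) + 1) * (K - \<Psi>' (U z)) * (V (z + 1) - V z))"
          unfolding left[OF z] by (simp add: algebra_simps)
        moreover have "0 \<le> (\<Psi> (U z) + 1) * (K - \<Psi>' (U z)) * (V (z + 1) - V z)"
          using \<Psi>U(1)[of z] \<Psi>'U[of z] V_inc[of z] by (intro mult_nonneg_nonneg) auto
        ultimately show "\<exists>y. (D has_real_derivative y) (at z) \<and> y \<le> 0" by auto
      next
        show "continuous_on {x1..x} D"
          unfolding D_def
          by (intro continuous_intros E_con \<Psi>U_con) simp
      qed (simp add: x1_def)
      moreover have "D x1 = K * e0" using far_left[of x1] by (simp add: D_def x1_def Psi_m1)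
      moreover have "(P x - \<Psi> (U x))\<^sup>2 = (\<Psi> (U x) + 1)\<^sup>2"
        unfolding left[OF 1] by (simp add: power2_eq_square algebra_simps)
      ultimately show ?thesis by (simp add: D_def right_diff_distrib)
    next
      case 2
      then show ?thesis using mid[OF 2] E_bounds(1)[of x] K_nonneg by simp
    next
      case 3
      define D where "D = (\<lambda>x. (\<Psi> (U x) - 1)\<^sup>2 / 2 + K * E x)"
      have "D x \<le> D (L + 1)"
      proof (rule DERIV_nonneg_imp_increasing_open[where f=D])
        fix z assume "x < z" "z < L + 1"
        then have z: "L < z" "z < L + 1" using 3 by auto
        have "(D has_real_derivative (\<Psi> (U z) - 1) * (\<Psi>' (U z) * (V (z + 1) - V z))
            + K * ((P z - \<Psi> (U z)) * (V (z + 1) - V z))) (at z)"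
          unfolding D_def using z L
          by (auto intro!: derivative_eq_intros d\<Psi>U dE)
        moreover have "(\<Psi> (U z) - 1) * (\<Psi>' (U z) * (V (z + 1) - V z))
            + K * ((P z - \<Psi> (U z)) * (V (z + 1) - V z))
          = (1 - \<Psi> (U z)) * (K - \<Psi>' (U z)) * (V (z + 1) - V z)"
          using z by (simp add: right algebra_simps)
        moreover have "0 \<le> (1 - \<Psi> (U z)) * (K - \<Psi>' (U z)) * (V (z + 1) - V z)"
          using \<Psi>U(2)[of z] \<Psi>'U[of z] V_inc[of z] by (intro mult_nonneg_nonneg) auto
        ultimately show "\<exists>y. (D has_real_derivative y) (at z) \<and> 0 \<le> y" by auto
      next
        show "continuous_on {x..L + 1} D"
          unfolding D_def
          by (intro continuous_intros E_con \<Psi>U_con) simp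
      qed (use 3 in simp)
      moreover have "D (L + 1) = K * e0" using far_right[of "L + 1"] by (simp add: D_def Psi_1)
      moreover have "(P x - \<Psi> (U x))\<^sup>2 = (\<Psi> (U x) - 1)\<^sup>2"
        using right[of x] 3 by (simp add: power2_commute)
      ultimately show ?thesis by (simp add: D_def right_diff_distrib)
    next
      case 4
      then show ?thesis using right[of x] far_right[of x] by (simp add: Psi_1)
    qed
  qed
  have defect': "(P x - \<Psi> (U x))\<^sup>2 \<le> 12 * K / n" for x
  proof -
    have "K * (e0 - E x) \<le> K * (3 * \<epsilon>)"
      using E_bounds(2)[of x] K_nonneg by (intro mult_left_mono) auto
    then show ?thesis using defect[of x] by (simp add: \<epsilon>_def L_def)
  qed

  \<comment> \<open>Centre at a zero of the strain. All bounds are uniform in x, so the translation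
    preserves them wherever the zero lies.\<close>
  have "\<exists>s. -L - 2 \<le> s \<and> s \<le> L + 1 \<and> U s = 0"
    using far_left(1)[of "-L-2"] far_right(1)[of "L+1"] L isCont_strain[OF P]
    by (intro IVT) (auto simp: U_def)
  then obtain s where s: "U s = 0" by blast
  show thesis
  proof (rule that[of "\<lambda>x. P (x + s)"])
    show "e0 - 6 / n \<le> energy (\<lambda>x. P (x + s)) x" for x
      using E_bounds(2)[of "x + s"] by (simp add: energy_shift E_def \<epsilon>_def L_def)
  qed (use s E_bounds(1) defect' in \<open>simp_all add: profile_shift P strain_shift energy_shift U_def E_def\<close>)
qed

end

section \<open>Passage to the limit\<close>

lemma vel_tendsto:
  assumes "profile P"
  shows "(P \<longlongrightarrow> l) at_top \<Longrightarrow> (vel P \<longlongrightarrow> l) at_top"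
    "(P \<longlongrightarrow> l) at_bot \<Longrightarrow> (vel P \<longlongrightarrow> l) at_bot"
proof -
  note li = profileD(6)[OF profile_shift[OF assms]]
  show "(vel P \<longlongrightarrow> l) at_top" if "(P \<longlongrightarrow> l) at_top"
    unfolding vel_eq by (rule win_tendsto_at_top[OF li shift_tendsto_at_top[OF that]])
  show "(vel P \<longlongrightarrow> l) at_bot" if "(P \<longlongrightarrow> l) at_bot"
    unfolding vel_eq by (rule win_tendsto_at_bot[OF li shift_tendsto_at_bot[OF that]])
qed

lemma strain_tendsto:
  assumes "profile P"
  shows "(P \<longlongrightarrow> l) at_top \<Longrightarrow> (strain P \<longlongrightarrow> l) at_top"
    "(P \<longlongrightarrow> l) at_bot \<Longrightarrow> (strain P \<longlongrightarrow> l) at_bot"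
proof -
  note li = profileD(6)[OF profile_vel[OF assms]]
  show "(strain P \<longlongrightarrow> l) at_top" if "(P \<longlongrightarrow> l) at_top"
    unfolding strain_def by (rule win_tendsto_at_top[OF li vel_tendsto(1)[OF assms that]])
  show "(strain P \<longlongrightarrow> l) at_bot" if "(P \<longlongrightarrow> l) at_bot"
    unfolding strain_def by (rule win_tendsto_at_bot[OF li vel_tendsto(2)[OF assms that]])
qed

lemma flux_tendsto:
  assumes "profile P"
  shows "(P \<longlongrightarrow> l) at_top \<Longrightarrow> (win (flux P) \<longlongrightarrow> l * l) at_top"
    "(P \<longlongrightarrow> l) at_bot \<Longrightarrow> (win (flux P) \<longlongrightarrow> l * l) at_bot"
proof -
  have eq: "flux P = (\<lambda>x. vel P x * P (x + (-1)))" by (simp add: flux_def[abs_def])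
  show "(win (flux P) \<longlongrightarrow> l * l) at_top" if "(P \<longlongrightarrow> l) at_top"
    by (rule win_tendsto_at_top[OF flux_locally_integrable[OF assms]], unfold eq)
       (rule tendsto_mult[OF vel_tendsto(1)[OF assms that] shift_tendsto_at_top[OF that]])
  show "(win (flux P) \<longlongrightarrow> l * l) at_bot" if "(P \<longlongrightarrow> l) at_bot"
    by (rule win_tendsto_at_bot[OF flux_locally_integrable[OF assms]], unfold eq)
       (rule tendsto_mult[OF vel_tendsto(2)[OF assms that] shift_tendsto_at_bot[OF that]])
qed

lemma profile_limits:
  assumes P: "profile P"
  obtains a b where "(P \<longlongrightarrow> a) at_bot" "(P \<longlongrightarrow> b) at_top" "a \<le> P x" "P x \<le> b" "-1 \<le> a" "b \<le> 1"
proof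
  have bdd: "bdd_above (range P)" "bdd_below (range P)"
    using profileD(3,4)[OF P] by (auto intro!: bdd_aboveI[of _ 1] bdd_belowI[of _ "-1"])
  show "(P \<longlongrightarrow> Inf (range P)) at_bot"
  proof (rule decreasing_tendsto)
    show "\<forall>\<^sub>F x in at_bot. Inf (range P) \<le> P x" using bdd(2) by (auto intro!: always_eventually cINF_lower)
    fix c assume "Inf (range P) < c"
    then obtain y where "P y < c" using bdd(2) by (auto simp: cINF_less_iff)
    then have "P x < c" if "x \<le> y" for x using profileD(5)[OF P that] by simp
    then show "\<forall>\<^sub>F x in at_bot. P x < c" by (auto simp: eventually_at_bot_linorder)
  qed
  show "(P \<longlongrightarrow> Sup (range P)) at_top"
  proof (rule increasing_tendsto)
    show "\<forall>\<^sub>F x in at_top. P x \<le> Sup (range P)" using bdd(1) by (auto intro!: always_eventually cSUP_upper)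
    fix c assume "c < Sup (range P)"
    then obtain y where "c < P y" using bdd(1) by (auto simp: less_cSUP_iff)
    then have "c < P x" if "x \<ge> y" for x using profileD(5)[OF P that] by simp
    then show "\<forall>\<^sub>F x in at_top. c < P x" by (auto simp: eventually_at_top_linorder)
  qed
  show "Inf (range P) \<le> P x" "P x \<le> Sup (range P)" using bdd by (auto intro: cINF_lower cSUP_upper)
  show "-1 \<le> Inf (range P)" "Sup (range P) \<le> 1"
    using profileD(3,4)[OF P] by (auto intro: cINF_greatest cSUP_least)
qed

text \<open>A diagonal subsequence converges on the rationals, and the common Lipschitz bound
  transfers the Cauchy property to every real point. Pointwise convergence suffices for the averages
  by dominated convergence.\<close>

lemma equilipschitz_convergent_subsequence:
  fixes f :: "nat \<Rightarrow> real \<Rightarrow> real"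
  assumes bound: "\<And>n x. \<bar>f n x\<bar> \<le> M" and lip: "\<And>n x y. \<bar>f n x - f n y\<bar> \<le> C * \<bar>x - y\<bar>"
  obtains k g where "strict_mono (k :: nat \<Rightarrow> nat)" "\<And>x. (\<lambda>i. f (k i) x) \<longlonglongrightarrow> g x"
proof -
  obtain k where k: "strict_mono (k::nat\<Rightarrow>nat)" "\<And>q. q \<in> \<rat> \<Longrightarrow> \<exists>l. (\<lambda>i. f (k i) q) \<longlonglongrightarrow> l"
    using function_convergent_subsequence[of "\<rat>" f M] bound countable_rat by auto
  have C: "0 \<le> C" using lip[of 0 0 1] by simp
  have "Cauchy (\<lambda>i. f (k i) x)" for x
  proof (rule CauchyI)
    fix e :: real assume e: "0 < e"
    \<comment> \<open>The summand 1 keeps the denominator positive when \<open>C\<close> is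
      0.\<close>
    define d where "d = e / (4 * (C + 1))"
    have d: "0 < d" using e C by (simp add: d_def)
    obtain q where q: "q \<in> \<rat>" "x < q" "q < x + d" using Rats_dense_in_real[of x "x + d"] d by auto
    have "C * \<bar>x - q\<bar> \<le> (C + 1) * d" using q C by (intro mult_mono) auto
    also have "\<dots> = e / 4" using C by (simp add: d_def divide_simps)
    finally have *: "\<bar>f n x - f n q\<bar> \<le> e / 4" for n using lip[of n x q] by simp
    have "Cauchy (\<lambda>i. f (k i) q)" using k(2)[OF q(1)] by (auto intro: LIMSEQ_imp_Cauchy)
    then obtain N where N: "\<And>m n. m \<ge> N \<Longrightarrow> n \<ge> N \<Longrightarrow> norm (f (k m) q - f (k n) q) < e / 4"
      using CauchyD[of _ "e/4"] e by (metis divide_pos_pos zero_less_numeral)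
    show "\<exists>N. \<forall>m\<ge>N. \<forall>n\<ge>N. norm (f (k m) x - f (k n) x) < e"
    proof (intro exI[of _ N] allI impI)
      fix m n assume "N \<le> m" "N \<le> n"
      from N[OF this] *[of "k m"] *[of "k n"] e show "norm (f (k m) x - f (k n) x) < e"
        unfolding real_norm_def by linarith
    qed
  qed
  then have "\<exists>l. (\<lambda>i. f (k i) x) \<longlonglongrightarrow> l" for x
    by (simp add: Cauchy_convergent_iff convergent_def)
  then show thesis using k(1) that by metis
qed

context normalised_potential
begin

lemma energy_tendsto:
  assumes "profile P"
  shows "(P \<longlongrightarrow> l) at_top \<Longrightarrow> (energy P \<longlongrightarrow> l\<^sup>2 / 2 - F l) at_top"
    "(P \<longlongrightarrow> l) at_bot \<Longrightarrow> (energy P \<longlongrightarrow> l\<^sup>2 / 2 - F l) at_bot"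
proof -
  have eq: "l\<^sup>2 / 2 - F l = l * l - l\<^sup>2 / 2 - F l" by (simp add: power2_eq_square)
  show "(energy P \<longlongrightarrow> l\<^sup>2 / 2 - F l) at_top" if "(P \<longlongrightarrow> l) at_top"
    unfolding eq energy_def[abs_def]
    by (intro tendsto_diff tendsto_divide tendsto_power tendsto_const flux_tendsto vel_tendsto
        isCont_tendsto_compose[OF F_isCont] strain_tendsto assms that) simp
  show "(energy P \<longlongrightarrow> l\<^sup>2 / 2 - F l) at_bot" if "(P \<longlongrightarrow> l) at_bot"
    unfolding eq energy_def[abs_def]
    by (intro tendsto_diff tendsto_divide tendsto_power tendsto_const flux_tendsto vel_tendsto
        isCont_tendsto_compose[OF F_isCont] strain_tendsto assms that) simp
qed

lemma heteroclinic_profile: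
  obtains W where "profile W" "W = strain (\<lambda>x. \<Psi> (W x))" "(W \<longlongrightarrow> 1) at_top" "(W \<longlongrightarrow> -1) at_bot"
proof -
  have "\<exists>P. profile P \<and> strain P 0 = 0 \<and> (\<forall>x. energy P x \<le> e0) \<and> (\<forall>x. e0 - 6 / Suc n \<le> energy P x)
     \<and> (\<forall>x. (P x - \<Psi> (strain P x))\<^sup>2 \<le> 12 * K / Suc n)" for n
    by (rule truncated_solution[of "Suc n"]) auto
  then obtain P where P: "\<And>n. profile (P n)" and P0: "\<And>n. strain (P n) 0 = 0"
    and E_le: "\<And>n x. energy (P n) x \<le> e0" and E_ge: "\<And>n x. e0 - 6 / Suc n \<le> energy (P n) x"
    and defect: "\<And>n x. (P n x - \<Psi> (strain (P n) x))\<^sup>2 \<le> 12 * K / Suc n" by metis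
  \<comment> \<open>Compactness is applied to the strains, which are equi-Lipschitz, and not to the
    profiles, which may jump.\<close>
  obtain k W where k: "strict_mono (k :: nat \<Rightarrow> nat)" and W: "\<And>x. (\<lambda>i. strain (P (k i)) x) \<longlonglongrightarrow> W x"
    by (rule equilipschitz_convergent_subsequence[of "\<lambda>n. strain (P n)" 1 2])
       (auto intro: strain_lipschitz P profileD(2) profile_strain)
  define Q where "Q = (\<lambda>x. \<Psi> (W x))"
  have inv: "(\<lambda>i. c / real (Suc (k i))) \<longlonglongrightarrow> 0" for c
    using LIMSEQ_subseq_LIMSEQ[OF LIMSEQ_Suc[OF lim_const_over_n[of c]] k] by (simp add: o_def)
  \<comment> \<open>The vanishing defect transfers the convergence from the strains to the
    profiles.\<close>
  have Q: "(\<lambda>i. P (k i) x) \<longlonglongrightarrow> Q x" for x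
  proof -
    have "(\<lambda>i. (P (k i) x - \<Psi> (strain (P (k i)) x))\<^sup>2) \<longlonglongrightarrow> 0"
      by (rule tendsto_sandwich[OF _ _ tendsto_const inv[of "12 * K"]]) (use defect in auto)
    from tendsto_real_sqrt[OF this] have "(\<lambda>i. P (k i) x - \<Psi> (strain (P (k i)) x)) \<longlonglongrightarrow> 0"
      by (simp add: tendsto_rabs_zero_iff)
    from tendsto_add[OF this isCont_tendsto_compose[OF Psi_isCont W[of x]]] show ?thesis
      by (simp add: Q_def)
  qed
  have profQ: "profile Q" by (rule profile_limit[OF P Q])
  have profW: "profile W" by (rule profile_limit[OF profile_strain[OF P] W])
  have WQ: "W = strain Q" using LIMSEQ_unique[OF W strain_limit[OF P Q]] by blast
  have W0: "W 0 = 0" using LIMSEQ_unique[OF W[of 0]] P0 by simp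
  have E: "energy Q x = e0" for x
  proof (rule LIMSEQ_unique[OF energy_limit[OF P Q]])
    have "(\<lambda>i. e0 - 6 / real (Suc (k i))) \<longlonglongrightarrow> e0"
      using tendsto_diff[OF tendsto_const inv[of 6], of e0] by simp
    then show "(\<lambda>i. energy (P (k i)) x) \<longlonglongrightarrow> e0"
      by (rule tendsto_sandwich[OF _ _ _ tendsto_const, rotated 2]) (use E_le E_ge in auto)
  qed
  have end_state: "\<bar>l\<bar> = 1" if l: "l = \<Psi> l" "l\<^sup>2 / 2 - F l = e0" "\<bar>l\<bar> \<le> 1" for l
    using area[of l] l by (force simp: e0_def)
  \<comment> \<open>The normalisation W 0 = 0 separates the two limits by sign, which later decides
    between -1 and 1 and rules out a constant profile.\<close>
  obtain a b where ab: "(W \<longlongrightarrow> a) at_bot" "(W \<longlongrightarrow> b) at_top" "a \<le> 0" "0 \<le> b" "-1 \<le> a" "b \<le> 1"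
    using profile_limits[OF profW, of 0] W0 by metis
  have Qab: "(Q \<longlongrightarrow> \<Psi> a) at_bot" "(Q \<longlongrightarrow> \<Psi> b) at_top"
    unfolding Q_def by (rule isCont_tendsto_compose[OF Psi_isCont ab(1)] isCont_tendsto_compose[OF Psi_isCont ab(2)])+
  \<comment> \<open>Averaging preserves limits at infinity, so W and \<Psi> composed with W have the
    same end states; the energy limits can then be evaluated at \<open>a\<close> and
    \<open>b\<close>.\<close>
  have "a = \<Psi> a" "b = \<Psi> b"
    using tendsto_unique[OF _ ab(1)] tendsto_unique[OF _ ab(2)] strain_tendsto[OF profQ] Qab WQ by auto
  moreover have "a\<^sup>2 / 2 - F a = e0" "b\<^sup>2 / 2 - F b = e0"
    using energy_tendsto(2)[OF profQ Qab(1)] energy_tendsto(1)[OF profQ Qab(2)]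
    by (simp_all add: E[abs_def] tendsto_const_iff flip: \<open>a = \<Psi> a\<close> \<open>b = \<Psi> b\<close>)
  ultimately have "\<bar>a\<bar> = 1" "\<bar>b\<bar> = 1" using end_state[of a] end_state[of b] ab by auto
  then have "a = -1" "b = 1" using ab by auto
  then show thesis
    using ab(1,2) by (intro that[OF profW WQ[unfolded Q_def]]) simp_all
qed

text \<open>Differentiating the outer average gives the equation for W, and differentiating the
  inner one gives the equation for V.\<close>

lemma heteroclinic_wave:
  obtains W V where "profile W" "profile V"
    "(W \<longlongrightarrow> 1) at_top" "(W \<longlongrightarrow> -1) at_bot" "(V \<longlongrightarrow> 1) at_top" "(V \<longlongrightarrow> -1) at_bot"
    "\<And>x. (W has_real_derivative V (x + 1) - V x) (at x)"
    "\<And>x. (V has_real_derivative \<Psi> (W x) - \<Psi> (W (x - 1))) (at x)"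
proof -
  obtain W where W: "profile W" "W = strain (\<lambda>x. \<Psi> (W x))" "(W \<longlongrightarrow> 1) at_top" "(W \<longlongrightarrow> -1) at_bot"
    by (rule heteroclinic_profile)
  define Q where "Q = (\<lambda>x. \<Psi> (W x))"
  have Q: "profile Q"
    using profileD[OF W(1)] Psi_bounds(3) monoD[OF Psi_mono] by (simp add: profile_def Q_def mono_def)
  have WQ: "W = strain Q" using W(2) by (simp add: Q_def)
  have Wc: "isCont W x" for x unfolding WQ by (rule isCont_strain[OF Q])
  have Qc: "isCont Q x" for x unfolding Q_def by (rule isCont_o2[OF Wc Psi_isCont])
  have lQ: "(Q \<longlongrightarrow> 1) at_top" "(Q \<longlongrightarrow> -1) at_bot"
    using isCont_tendsto_compose[OF Psi_isCont W(3)] isCont_tendsto_compose[OF Psi_isCont W(4)]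
    by (simp_all add: Q_def Psi_1 Psi_m1)
  show thesis
  proof (rule that[of W "vel Q"])
    show "(W has_real_derivative vel Q (x + 1) - vel Q x) (at x)" for x
      unfolding WQ by (rule strain_has_derivative[OF Q])
    show "(vel Q has_real_derivative \<Psi> (W x) - \<Psi> (W (x - 1))) (at x)" for x
      using vel_has_derivative[OF Q Qc Qc] by (simp add: Q_def)
  qed (use W(1,3,4) Q lQ vel_tendsto[OF Q] profile_vel in auto)
qed

end

section \<open>Fronts from conservative shocks\<close>

lemma smooth_fun_derivs:
  assumes "smooth_fun \<Phi>"
  shows "(\<Phi> has_real_derivative deriv \<Phi> x) (at x)"
    "(deriv \<Phi> has_real_derivative deriv (deriv \<Phi>) x) (at x)"
    "isCont (deriv (deriv \<Phi>)) x"
proof -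
  have d: "((deriv ^^ n) \<Phi>) differentiable (at x)" for n using assms by (simp add: smooth_fun_def)
  show "(\<Phi> has_real_derivative deriv \<Phi> x) (at x)"
    "(deriv \<Phi> has_real_derivative deriv (deriv \<Phi>) x) (at x)"
    using d[of 0] d[of 1] by (simp_all add: DERIV_deriv_iff_real_differentiable)
  show "isCont (deriv (deriv \<Phi>)) x"
    using d[of 2] by (simp add: differentiable_imp_continuous_within numeral_2_eq_2)
qed

text \<open>Add the tangent inequalities at two points.\<close>

lemma convex_on_deriv_mono:
  fixes f :: "real \<Rightarrow> real"
  assumes "convex_on UNIV f" and d: "\<And>x. (f has_real_derivative f' x) (at x)"
  shows "mono f'"
proof (rule monoI)
  fix x y :: real assume "x \<le> y"
  have tan: "f' c * (z - c) \<le> f z - f c" for c z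
    by (rule convex_on_imp_above_tangent[OF assms(1)]) (use d in auto)
  have "f' x * (y - x) \<le> f' y * (y - x)"
    using tan[of x y] tan[of y x] by (simp add: algebra_simps)
  then show "f' x \<le> f' y" using \<open>x \<le> y\<close> by (cases "x = y") (auto simp: mult_le_cancel_right)
qed

lemma mono_scaled_profile:
  assumes "profile P"
  shows "mono (\<lambda>x. a + b * P x) \<or> antimono (\<lambda>x. a + b * P x)"
  using profileD(5)[OF assms]
  by (cases "b \<ge> 0") (auto simp: mono_def antimono_def mult_left_mono mult_left_mono_neg)

lemma bounded_scaled_profile:
  assumes "profile P" shows "bounded (range (\<lambda>x. a + b * P x))"
proof (rule boundedI)
  fix y assume "y \<in> range (\<lambda>x. a + b * P x)"
  then obtain x where "y = a + b * P x" by blast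
  moreover have "\<bar>b * P x\<bar> \<le> \<bar>b\<bar> * 1"
    unfolding abs_mult by (intro mult_left_mono profileD(2)[OF assms]) simp
  ultimately show "norm y \<le> \<bar>a\<bar> + \<bar>b\<bar>" by simp
qed

lemma supersonic_shock_imp_front:
  assumes smooth: "smooth_fun \<Phi>" and convex: "convex_on UNIV \<Phi>"
    and ne: "(rm, vm) \<noteq> (rp, vp)" and shock: "conservative_shock \<Phi> \<sigma> rm vm rp vp"
    and \<sigma>: "\<sigma> \<noteq> 0"
    and area: "\<And>w. -1 < w \<Longrightarrow> w < 1 \<Longrightarrow> g_area \<Phi> rm vm rp vp w > 0"
  shows "\<exists>R V. is_front \<Phi> \<sigma> rm vm rp vp R V \<and> (mono R \<or> antimono R) \<and> (mono V \<or> antimono V)"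
proof -
  define \<phi> where "\<phi> = deriv \<Phi>"
  define \<phi>' where "\<phi>' = deriv \<phi>"
  have d\<Phi>: "(\<Phi> has_real_derivative \<phi> x) (at x)"
    and d\<phi>: "(\<phi> has_real_derivative \<phi>' x) (at x)" and c\<phi>': "isCont \<phi>' x" for x
    using smooth_fun_derivs[OF smooth] by (simp_all add: \<phi>_def \<phi>'_def)
  have mono_\<phi>: "mono \<phi>" by (rule convex_on_deriv_mono[OF convex d\<Phi>])
  define J M where "J = rp - rm" and "M = (rp + rm) / 2"
  define J\<phi> M\<phi> where "J\<phi> = \<phi> rp - \<phi> rm" and "M\<phi> = (\<phi> rp + \<phi> rm) / 2"
  define JV MV where "JV = vp - vm" and "MV = (vp + vm) / 2"
  have j1: "\<sigma> * J + JV = 0" and j2: "\<sigma> * JV + J\<phi> = 0"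
    and j3: "\<sigma> * ((vp\<^sup>2 / 2 + \<Phi> rp) - (vm\<^sup>2 / 2 + \<Phi> rm)) + (\<phi> rp * vp - \<phi> rm * vm) = 0"
    using shock by (simp_all add: conservative_shock_def jump_def J_def JV_def J\<phi>_def \<phi>_def)
  have JV: "JV = - (\<sigma> * J)" using j1 by simp
  have J\<phi>: "J\<phi> = \<sigma> * \<sigma> * J" using j2 by (simp add: JV)
  have "J \<noteq> 0"
  proof
    assume "J = 0"
    then have "JV = 0" by (simp add: JV)
    with \<open>J = 0\<close> ne show False by (simp add: J_def JV_def)
  qed
  then have J0: "J \<noteq> 0" "J\<phi> \<noteq> 0" using \<sigma> by (simp_all add: J\<phi>)
  \<comment> \<open>Expand jumps of products into means times jumps and subtract multiples of the
    first two conditions from the third. The resulting trapezoidal identity is what makes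
    \<open>F\<close> agree at -1 and 1.\<close>
  have \<Phi>_jump: "\<Phi> rp - \<Phi> rm = M\<phi> * J"
  proof -
    have "\<sigma> * (\<Phi> rp - \<Phi> rm - M\<phi> * J) =
      \<sigma> * ((vp\<^sup>2 / 2 + \<Phi> rp) - (vm\<^sup>2 / 2 + \<Phi> rm)) + (\<phi> rp * vp - \<phi> rm * vm)
        - MV * (\<sigma> * JV + J\<phi>) - M\<phi> * (\<sigma> * J + JV)"
      by (simp add: M\<phi>_def MV_def J\<phi>_def JV_def J_def power2_eq_square field_simps)
    also have "\<dots> = 0" using j1 j2 j3 by simp
    finally show ?thesis using \<sigma> by simp
  qed

  define F where "F = Phi_hat \<Phi> rm vm rp vp"
  have F: "F w = 4 / (J\<phi> * J) * \<Phi> (M + J / 2 * w) - 2 * M\<phi> / J\<phi> * w" for w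
    by (simp add: F_def Phi_hat_def jump_def mean_def J_def M_def J\<phi>_def M\<phi>_def \<phi>_def)
  define \<Psi> where "\<Psi> = (\<lambda>w. 2 / J\<phi> * (\<phi> (M + J / 2 * w) - M\<phi>))"
  define \<Psi>' where "\<Psi>' = (\<lambda>w. J / J\<phi> * \<phi>' (M + J / 2 * w))"
  have lin: "((\<lambda>w. M + J / 2 * w) has_real_derivative J / 2) (at w)" for w
    by (auto intro!: derivative_eq_intros)
  have dF: "(F has_real_derivative \<Psi> w) (at w)" for w
  proof -
    have "(F has_real_derivative 4 / (J\<phi> * J) * (\<phi> (M + J / 2 * w) * (J / 2)) - 2 * M\<phi> / J\<phi> * 1) (at w)"
      unfolding F[abs_def] by (intro DERIV_diff DERIV_cmult DERIV_chain2[OF d\<Phi> lin] DERIV_ident)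
    moreover have "4 / (J\<phi> * J) * (\<phi> (M + J / 2 * w) * (J / 2)) - 2 * M\<phi> / J\<phi> * 1 = \<Psi> w"
      using J0 by (simp add: \<Psi>_def field_simps)
    ultimately show ?thesis by simp
  qed
  have d\<Psi>: "(\<Psi> has_real_derivative \<Psi>' w) (at w)" for w
  proof -
    have "(\<Psi> has_real_derivative 2 / J\<phi> * (\<phi>' (M + J / 2 * w) * (J / 2) - 0)) (at w)"
      unfolding \<Psi>_def by (intro DERIV_diff DERIV_cmult DERIV_chain2[OF d\<phi> lin] DERIV_const)
    then show ?thesis by (simp add: \<Psi>'_def mult.commute)
  qed
  have \<Psi>: "\<phi> (M + J / 2 * w) = M\<phi> + J\<phi> / 2 * \<Psi> w" for w
    using J0 by (simp add: \<Psi>_def field_simps)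
  have ends: "M + J / 2 = rp" "M - J / 2 = rm"
    by (simp_all add: M_def J_def field_simps)
  have \<Psi>_ends: "\<Psi> 1 = 1" "\<Psi> (-1) = -1"
  proof -
    have "\<phi> rp - M\<phi> = J\<phi> / 2" "\<phi> rm - M\<phi> = - (J\<phi> / 2)"
      by (simp_all add: M\<phi>_def J\<phi>_def field_simps)
    then have "\<Psi> 1 = 2 / J\<phi> * (J\<phi> / 2)" "\<Psi> (-1) = 2 / J\<phi> * - (J\<phi> / 2)"
      unfolding \<Psi>_def by (simp_all only: ends mult_1_right mult_minus1_right flip: diff_conv_add_uminus)
    then show "\<Psi> 1 = 1" "\<Psi> (-1) = -1"
      using J0(2) by simp_all
  qed
  have mono_\<Psi>: "mono \<Psi>"
  proof (rule monoI)
    fix x y :: real assume "x \<le> y"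
    \<comment> \<open>Dividing by \<open>J\<close> treats rising and falling fronts alike, since
      \<open>J\<phi>\<close> and \<open>J\<close> have the same sign.\<close>
    have "0 \<le> (\<phi> (M + J / 2 * y) - \<phi> (M + J / 2 * x)) / J"
    proof (cases "J > 0")
      case True
      then have "\<phi> (M + J / 2 * x) \<le> \<phi> (M + J / 2 * y)"
        using \<open>x \<le> y\<close> by (intro monoD[OF mono_\<phi>]) (simp add: mult_left_mono)
      then show ?thesis using True by simp
    next
      case False
      then have "\<phi> (M + J / 2 * y) \<le> \<phi> (M + J / 2 * x)"
        using \<open>x \<le> y\<close> by (intro monoD[OF mono_\<phi>]) (simp add: mult_left_mono_neg)
      then show ?thesis using False by (simp add: divide_nonpos_nonpos)
    qed
    moreover have "\<Psi> y - \<Psi> x = 2 / (\<sigma> * \<sigma>) * ((\<phi> (M + J / 2 * y) - \<phi> (M + J / 2 * x)) / J)"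
      using J0 \<sigma> by (simp add: \<Psi>_def J\<phi> field_simps)
    ultimately have "0 \<le> \<Psi> y - \<Psi> x" by (metis mult_nonneg_nonneg zero_le_divide_iff zero_le_numeral zero_le_square)
    then show "\<Psi> x \<le> \<Psi> y" by simp
  qed
  have F_ends: "F (-1) = F 1"
  proof -
    have "F 1 - F (-1) = 4 / (J\<phi> * J) * (\<Phi> rp - \<Phi> rm) - 4 * M\<phi> / J\<phi>"
      by (simp add: F ends right_diff_distrib diff_divide_distrib)
    also have "\<dots> = 0" unfolding \<Phi>_jump using J0 by simp
    finally show ?thesis by simp
  qed
  obtain K where K: "\<And>w. \<bar>w\<bar> \<le> 1 \<Longrightarrow> \<bar>\<Psi>' w\<bar> \<le> K"
  proof -
    have "isCont \<Psi>' w" for w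
      unfolding \<Psi>'_def by (intro isCont_mult isCont_o2[OF DERIV_isCont[OF lin] c\<phi>']) simp
    then have "compact (\<Psi>' ` {-1..1})"
      by (intro compact_continuous_image continuous_at_imp_continuous_on) auto
    then have "bounded (\<Psi>' ` {-1..1})" by (rule compact_imp_bounded)
    then obtain K where K: "\<forall>w\<in>{-1..1}. \<bar>\<Psi>' w\<bar> \<le> K"
      unfolding bounded_iff by auto
    have "\<bar>\<Psi>' w\<bar> \<le> K" if "\<bar>w\<bar> \<le> 1" for w
      by (rule bspec[OF K]) (use that in \<open>simp add: abs_le_iff\<close>)
    then show thesis by (rule that)
  qed
  have gap: "1/2 - F 1 < w\<^sup>2/2 - F w" if w: "-1 < w" "w < 1" for w
  proof -
    have "deriv F u = \<Psi> u" for u by (rule DERIV_imp_deriv[OF dF])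
    then have "g_area \<Phi> rm vm rp vp w = integral {-1..w} (\<lambda>u. u - \<Psi> u)"
      by (simp add: g_area_def F_def)
    moreover have "((\<lambda>u. u - \<Psi> u) has_integral (w\<^sup>2/2 - F w) - ((-1)\<^sup>2/2 - F (-1))) {-1..w}"
      using w by (intro fundamental_theorem_of_calculus)
        (auto intro!: derivative_eq_intros has_field_derivative_at_within[OF dF] simp flip: has_real_derivative_iff_has_vector_derivative)
    ultimately have "g_area \<Phi> rm vm rp vp w = (w\<^sup>2/2 - F w) - (1/2 - F (-1))"
      by (simp add: integral_unique)
    then show ?thesis using area[OF w] F_ends by simp
  qed
  interpret normalised_potential F \<Psi> \<Psi>' K
    by unfold_locales (fact dF d\<Psi> mono_\<Psi> \<Psi>_ends F_ends K gap)+

  obtain W V where W: "profile W" and V: "profile V"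
    and limW: "(W \<longlongrightarrow> 1) at_top" "(W \<longlongrightarrow> -1) at_bot" and limV: "(V \<longlongrightarrow> 1) at_top" "(V \<longlongrightarrow> -1) at_bot"
    and dW: "\<And>x. (W has_real_derivative V (x + 1) - V x) (at x)"
    and dV: "\<And>x. (V has_real_derivative \<Psi> (W x) - \<Psi> (W (x - 1))) (at x)"
    using heteroclinic_wave by blast
  have cW: "isCont W x" and cV: "isCont V x" for x using DERIV_isCont dW dV by blast+
  define R U where "R = (\<lambda>x. M + J / 2 * W x)" and "U = (\<lambda>x. MV + JV / 2 * V x)"
  have dR: "(R has_real_derivative J / 2 * (V (x + 1) - V x)) (at x)" for x
    unfolding R_def by (auto intro!: derivative_eq_intros dW)
  have dU: "(U has_real_derivative JV / 2 * (\<Psi> (W x) - \<Psi> (W (x - 1)))) (at x)" for x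
    unfolding U_def by (auto intro!: derivative_eq_intros dV)
  have deriv_R: "deriv R = (\<lambda>x. J / 2 * (V (x + 1) - V x))"
    and deriv_U: "deriv U = (\<lambda>x. JV / 2 * (\<Psi> (W x) - \<Psi> (W (x - 1))))"
    using DERIV_imp_deriv[OF dR] DERIV_imp_deriv[OF dU] by auto
  have cV1: "isCont (\<lambda>x. V (x + 1)) x" for x
    by (rule isCont_o2[where f="\<lambda>x. x + 1", OF _ cV]) simp
  have cW1: "isCont (\<lambda>x. W (x - 1)) x" for x
    by (rule isCont_o2[where f="\<lambda>x. x - 1", OF _ cW]) simp
  have "isCont (deriv R) x" "isCont (deriv U) x" for x
    unfolding deriv_R deriv_U
    by (intro isCont_mult isCont_diff cV cV1 isCont_o2[OF cW Psi_isCont] isCont_o2[OF cW1 Psi_isCont]; simp)+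
  then have "continuous_on UNIV (deriv R)" "continuous_on UNIV (deriv U)"
    by (simp_all add: continuous_at_imp_continuous_on)
  moreover have "R differentiable (at x)" "U differentiable (at x)" for x
    using dR dU real_differentiable_def by blast+
  moreover have "bounded (range R)" "bounded (range U)"
    unfolding R_def U_def by (rule bounded_scaled_profile[OF W] bounded_scaled_profile[OF V])+
  ultimately have C1: "C1_bounded R" "C1_bounded U" by (simp_all add: C1_bounded_def)
  have lims: "(R \<longlongrightarrow> M + J / 2 * 1) at_top" "(R \<longlongrightarrow> M + J / 2 * (-1)) at_bot"
    "(U \<longlongrightarrow> MV + JV / 2 * 1) at_top" "(U \<longlongrightarrow> MV + JV / 2 * (-1)) at_bot"
    unfolding R_def U_def by (intro tendsto_add tendsto_mult tendsto_const limW limV)+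
  have ends_V: "MV + JV / 2 = vp" "MV - JV / 2 = vm"
    by (simp_all add: MV_def JV_def field_simps)
  have eq1: "\<sigma> * deriv R x + U (x + 1) - U x = 0" for x
    unfolding deriv_R U_def JV by (simp add: field_simps)
  have eq2: "\<sigma> * deriv U x + \<phi> (R x) - \<phi> (R (x - 1)) = 0" for x
    unfolding deriv_U R_def \<Psi> JV J\<phi> by (simp add: field_simps)
  have "is_front \<Phi> \<sigma> rm vm rp vp R U"
    using C1 lims eq1 eq2 by (simp add: is_front_def ends ends_V \<phi>_def)
  moreover have "mono R \<or> antimono R" "mono U \<or> antimono U"
    unfolding R_def U_def by (rule mono_scaled_profile[OF W] mono_scaled_profile[OF V])+
  ultimately show ?thesis by blast
qed

theorem theorem1p1:
  fixes \<Phi> :: "real \<Rightarrow> real"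
  assumes smooth: "smooth_fun \<Phi>"
    and convex: "convex_on UNIV \<Phi>"
  shows "(\<forall>\<sigma> rm vm rp vp R V. is_front \<Phi> \<sigma> rm vm rp vp R V
            \<longrightarrow> conservative_shock \<Phi> \<sigma> rm vm rp vp)
       \<and> (\<forall>\<sigma> rm vm rp vp.
            (rm, vm) \<noteq> (rp, vp) \<and> conservative_shock \<Phi> \<sigma> rm vm rp vp
            \<and> \<bar>\<sigma>\<bar> > sqrt (deriv (deriv \<Phi>) rm) \<and> \<bar>\<sigma>\<bar> > sqrt (deriv (deriv \<Phi>) rp)
            \<and> (\<forall>w. -1 < w \<and> w < 1 \<longrightarrow> g_area \<Phi> rm vm rp vp w > 0)
            \<longrightarrow> (\<exists>R V. is_front \<Phi> \<sigma> rm vm rp vp R V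
                     \<and> (mono R \<or> antimono R) \<and> (mono V \<or> antimono V)))"
proof (intro conjI allI impI)
  fix \<sigma> rm vm rp vp R V
  assume "is_front \<Phi> \<sigma> rm vm rp vp R V"
  then show "conservative_shock \<Phi> \<sigma> rm vm rp vp" by (rule front_imp_conservative_shock[OF smooth])
next
  fix \<sigma> rm vm rp vp
  assume *: "(rm, vm) \<noteq> (rp, vp) \<and> conservative_shock \<Phi> \<sigma> rm vm rp vp
    \<and> \<bar>\<sigma>\<bar> > sqrt (deriv (deriv \<Phi>) rm) \<and> \<bar>\<sigma>\<bar> > sqrt (deriv (deriv \<Phi>) rp)
    \<and> (\<forall>w. -1 < w \<and> w < 1 \<longrightarrow> g_area \<Phi> rm vm rp vp w > 0)"
  \<comment> \<open>As \<open>sqrt\<close> is negative at negative arguments, this sign is settled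
    first; then \<bar>\<sigma>\<bar> exceeds a nonnegative number.\<close>
  have "0 \<le> deriv (deriv \<Phi>) rm"
    by (rule mono_on_imp_deriv_nonneg[where A=UNIV, OF _ smooth_fun_derivs(2)[OF smooth]])
       (use convex_on_deriv_mono[OF convex smooth_fun_derivs(1)[OF smooth]] in auto)
  then have "\<sigma> \<noteq> 0" using * by (smt (verit) real_sqrt_ge_0_iff)
  then show "\<exists>R V. is_front \<Phi> \<sigma> rm vm rp vp R V \<and> (mono R \<or> antimono R) \<and> (mono V \<or> antimono V)"
    using * by (intro supersonic_shock_imp_front[OF smooth convex]) auto
qed

end
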